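(* Let $R$ be a subdirectly irreducible $*$-regular ring such that $\mathrm{Soc}(R)\neq 0$. Then $\mathrm{Soc}(R)=M(R)$; for each projection $e\in M(R)$ the ring $eRe$ is artinian; and $R$ is representable.
   Context: Rings are associative with unit $1$ as a constant (preserved by homomorphisms and embeddings). A ring $R$ is (von Neumann) regular if for each $a\in R$ there is $x\in R$ with $axa=a$. A $*$-ring is a ring $R$ endowed with an involution $r\mapsto r^*$; homomorphisms and embeddings of $*$-rings preserve the involution. A $*$-ring $R$ is $*$-regular if it is regular and $rr^*=0$ only for $r=0$. (In a $*$-regular ring every two-sided ideal is closed under the involution.) A projection is an idempotent $e$ with $e=e^*$. For a projection $e\in R$, the corner $eRe$ is the ring with unit $e$ and operations otherwise inherited from $R$. A $*$-regular ring $R$ is subdirectly irreducible if it has a unique minimal ideal, denoted by $M(R)$, i.e. a nonzero two-sided ideal contained in every nonzero two-sided ideal. $\mathrm{Soc}(R)$ denotes the socle of $R$ as a right $R$-module, i.e. the sum of all minimal right ideals of $R$ (for a regular ring the right and left socles coincide and form a two-sided ideal). An inner product space $V_F$ is a right vector space $V_F$ over a division $*$-ring $F$ (a division ring with involution), of arbitrary dimension, endowed with a sesquilinear form $\langle \cdot\mid\cdot\rangle$ with values in $F$ (with respect to the involution of $F$) which is anisotropic ($\langle v\mid v\rangle=0$ only for $v=0$) and orthosymmetric ($\langle v\mid w\rangle=0$ if and only if $\langle w\mid v\rangle=0$). $\mathrm{End}^*(V_F)$ denotes the $*$-ring of those endomorphisms $\varphi$ of the vector space $V_F$ which have an adjoint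 $\varphi^*$ with respect to $\langle\cdot\mid\cdot\rangle$, with involution $\varphi\mapsto\varphi^*$. A representation of a $*$-ring $R$ within $V_F$ is an embedding of $*$-rings of $R$ into $\mathrm{End}^*(V_F)$; $R$ is representable if it has a representation within some inner product space. *)

theory Defs
  imports "HOL-Algebra.Algebra"
begin

section \<open>Rings with involution\<close>

record 'a star_ring = "'a ring" +
  invol :: "'a \<Rightarrow> 'a" (\<open>(_\<^sup>\<star>\<index>)\<close> [1000] 999)

locale star_ring = ring R for R :: "('a, 'm) star_ring_scheme" (structure) +
  assumes invol_closed: "a \<in> carrier R \<Longrightarrow> a\<^sup>\<star> \<in> carrier R"
    and invol_add: "\<lbrakk>a \<in> carrier R; b \<in> carrier R\<rbrakk> \<Longrightarrow> (a \<oplus> b)\<^sup>\<star> = a\<^sup>\<star> \<oplus> b\<^sup>\<star>"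
    and invol_mult: "\<lbrakk>a \<in> carrier R; b \<in> carrier R\<rbrakk> \<Longrightarrow> (a \<otimes> b)\<^sup>\<star> = b\<^sup>\<star> \<otimes> a\<^sup>\<star>"
    and invol_invol: "a \<in> carrier R \<Longrightarrow> (a\<^sup>\<star>)\<^sup>\<star> = a"

locale regular_ring = ring +
  assumes regular: "a \<in> carrier R \<Longrightarrow> \<exists>x \<in> carrier R. a \<otimes> x \<otimes> a = a"

locale star_regular_ring = star_ring R + regular_ring R
  for R :: "('a, 'm) star_ring_scheme" (structure) +
  assumes proper: "\<lbrakk>a \<in> carrier R; a \<otimes> a\<^sup>\<star> = \<zero>\<rbrakk> \<Longrightarrow> a = \<zero>"

locale division_star_ring = star_ring F
  for F :: "('f, 'm) star_ring_scheme" (structure) +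
  assumes division_Units: "Units F = carrier F - {\<zero>}"

definition star_embedding ::
    "('a, 'm) star_ring_scheme \<Rightarrow> ('b, 'n) star_ring_scheme \<Rightarrow> ('a \<Rightarrow> 'b) \<Rightarrow> bool"
  where "star_embedding R S f \<longleftrightarrow>
    star_ring R \<and> star_ring S \<and> f \<in> ring_hom R S \<and> inj_on f (carrier R) \<and>
    (\<forall>r \<in> carrier R. f (r\<^sup>\<star>\<^bsub>R\<^esub>) = (f r)\<^sup>\<star>\<^bsub>S\<^esub>)"

definition projection :: "('a, 'm) star_ring_scheme \<Rightarrow> 'a \<Rightarrow> bool"
  where "projection R e \<longleftrightarrow> e \<in> carrier R \<and> e \<otimes>\<^bsub>R\<^esub> e = e \<and> e\<^sup>\<star>\<^bsub>R\<^esub> = e"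

definition corner :: "('a, 'm) ring_scheme \<Rightarrow> 'a \<Rightarrow> ('a, 'm) ring_scheme"
  where "corner R e =
    R\<lparr>carrier := {e \<otimes>\<^bsub>R\<^esub> r \<otimes>\<^bsub>R\<^esub> e | r. r \<in> carrier R}, one := e\<rparr>"


section \<open>One-sided ideals, chain conditions, socle\<close>

locale right_ideal = additive_subgroup I R + ring R for I and R (structure) +
  assumes r_closed: "\<lbrakk>a \<in> I; x \<in> carrier R\<rbrakk> \<Longrightarrow> a \<otimes> x \<in> I"

locale left_ideal = additive_subgroup I R + ring R for I and R (structure) +
  assumes l_closed: "\<lbrakk>a \<in> I; x \<in> carrier R\<rbrakk> \<Longrightarrow> x \<otimes> a \<in> I"

text \<open>Artinian means artinian on both sides; the zero ring is allowed.\<close>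

locale artinian_ring = ring +
  assumes right_dcc:
      "\<lbrakk>\<And>n::nat. right_ideal (C n) R; \<And>n. C (Suc n) \<subseteq> C n\<rbrakk> \<Longrightarrow> \<exists>n. \<forall>m\<ge>n. C m = C n"
    and left_dcc:
      "\<lbrakk>\<And>n::nat. left_ideal (C n) R; \<And>n. C (Suc n) \<subseteq> C n\<rbrakk> \<Longrightarrow> \<exists>n. \<forall>m\<ge>n. C m = C n"

definition minimal_right_ideal :: "'a set \<Rightarrow> ('a, 'm) ring_scheme \<Rightarrow> bool"
  where "minimal_right_ideal I R \<longleftrightarrow>
    right_ideal I R \<and> I \<noteq> {\<zero>\<^bsub>R\<^esub>} \<and>
    (\<forall>J. right_ideal J R \<and> J \<subseteq> I \<longrightarrow> J = {\<zero>\<^bsub>R\<^esub>} \<or> J = I)"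

text \<open>The sum of a family of right ideals is the additive subgroup generated by their union;
  in particular the empty sum is the zero ideal.\<close>

definition socle :: "('a, 'm) ring_scheme \<Rightarrow> 'a set"
  where "socle R = generate (add_monoid R) (\<Union>{I. minimal_right_ideal I R})"


section \<open>Subdirect irreducibility\<close>

definition least_nonzero_ideal :: "'a set \<Rightarrow> ('a, 'm) ring_scheme \<Rightarrow> bool"
  where "least_nonzero_ideal M R \<longleftrightarrow>
    ideal M R \<and> M \<noteq> {\<zero>\<^bsub>R\<^esub>} \<and> (\<forall>I. ideal I R \<and> I \<noteq> {\<zero>\<^bsub>R\<^esub>} \<longrightarrow> M \<subseteq> I)"

definition subdirectly_irreducible :: "('a, 'm) ring_scheme \<Rightarrow> bool"
  where "subdirectly_irreducible R \<longleftrightarrow> (\<exists>M. least_nonzero_ideal M R)"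

definition minimal_ideal :: "('a, 'm) ring_scheme \<Rightarrow> 'a set"
  where "minimal_ideal R = (THE M. least_nonzero_ideal M R)"

lemma least_nonzero_ideal_unique:
  "\<lbrakk>least_nonzero_ideal M R; least_nonzero_ideal N R\<rbrakk> \<Longrightarrow> M = N"
  unfolding least_nonzero_ideal_def by blast

lemma least_nonzero_ideal_minimal_ideal:
  "subdirectly_irreducible R \<Longrightarrow> least_nonzero_ideal (minimal_ideal R) R"
  unfolding subdirectly_irreducible_def minimal_ideal_def
  by (metis least_nonzero_ideal_unique theI)


section \<open>Inner product spaces\<close>

text \<open>As for modules in the library, only the additive part of the underlying ring record
  of the space is used.\<close>

record ('f, 'v) inner_space = "'v ring" +
  rsmult :: "'v \<Rightarrow> 'f \<Rightarrow> 'v" (infixl \<open>\<bullet>\<index>\<close> 70)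
  form :: "'v \<Rightarrow> 'v \<Rightarrow> 'f"

locale inner_product_space = F?: division_star_ring F + V?: abelian_group V
  for F :: "('f, 'm) star_ring_scheme" (structure)
    and V :: "('f, 'v, 'n) inner_space_scheme" (structure) +
  assumes rsmult_closed:
      "\<lbrakk>v \<in> carrier V; a \<in> carrier F\<rbrakk> \<Longrightarrow> v \<bullet>\<^bsub>V\<^esub> a \<in> carrier V"
    and rsmult_add_left:
      "\<lbrakk>v \<in> carrier V; w \<in> carrier V; a \<in> carrier F\<rbrakk> \<Longrightarrow>
        (v \<oplus>\<^bsub>V\<^esub> w) \<bullet>\<^bsub>V\<^esub> a = v \<bullet>\<^bsub>V\<^esub> a \<oplus>\<^bsub>V\<^esub> w \<bullet>\<^bsub>V\<^esub> a"
    and rsmult_add_right: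
      "\<lbrakk>v \<in> carrier V; a \<in> carrier F; b \<in> carrier F\<rbrakk> \<Longrightarrow>
        v \<bullet>\<^bsub>V\<^esub> (a \<oplus> b) = v \<bullet>\<^bsub>V\<^esub> a \<oplus>\<^bsub>V\<^esub> v \<bullet>\<^bsub>V\<^esub> b"
    and rsmult_assoc:
      "\<lbrakk>v \<in> carrier V; a \<in> carrier F; b \<in> carrier F\<rbrakk> \<Longrightarrow>
        v \<bullet>\<^bsub>V\<^esub> (a \<otimes> b) = (v \<bullet>\<^bsub>V\<^esub> a) \<bullet>\<^bsub>V\<^esub> b"
    and rsmult_one: "v \<in> carrier V \<Longrightarrow> v \<bullet>\<^bsub>V\<^esub> \<one> = v"
    and form_closed:
      "\<lbrakk>v \<in> carrier V; w \<in> carrier V\<rbrakk> \<Longrightarrow> form V v w \<in> carrier F"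
    and form_add_left:
      "\<lbrakk>u \<in> carrier V; v \<in> carrier V; w \<in> carrier V\<rbrakk> \<Longrightarrow>
        form V (u \<oplus>\<^bsub>V\<^esub> v) w = form V u w \<oplus> form V v w"
    and form_add_right:
      "\<lbrakk>u \<in> carrier V; v \<in> carrier V; w \<in> carrier V\<rbrakk> \<Longrightarrow>
        form V u (v \<oplus>\<^bsub>V\<^esub> w) = form V u v \<oplus> form V u w"
    and form_rsmult:
      "\<lbrakk>v \<in> carrier V; w \<in> carrier V; a \<in> carrier F; b \<in> carrier F\<rbrakk> \<Longrightarrow>
        form V (v \<bullet>\<^bsub>V\<^esub> a) (w \<bullet>\<^bsub>V\<^esub> b) = a\<^sup>\<star> \<otimes> form V v w \<otimes> b"
    and anisotropic: "\<lbrakk>v \<in> carrier V; form V v v = \<zero>\<rbrakk> \<Longrightarrow> v = \<zero>\<^bsub>V\<^esub>"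
    and orthosymmetric:
      "\<lbrakk>v \<in> carrier V; w \<in> carrier V\<rbrakk> \<Longrightarrow> form V v w = \<zero> \<longleftrightarrow> form V w v = \<zero>"

text \<open>Endomorphisms are extensional functions on the carrier, so that equality of functions
  is equality of endomorphisms.\<close>

definition endomorphisms ::
    "('f, 'm) star_ring_scheme \<Rightarrow> ('f, 'v, 'n) inner_space_scheme \<Rightarrow> ('v \<Rightarrow> 'v) set"
  where "endomorphisms F V =
    {\<phi> \<in> carrier V \<rightarrow>\<^sub>E carrier V.
      (\<forall>v \<in> carrier V. \<forall>w \<in> carrier V. \<phi> (v \<oplus>\<^bsub>V\<^esub> w) = \<phi> v \<oplus>\<^bsub>V\<^esub> \<phi> w) \<and>
      (\<forall>v \<in> carrier V. \<forall>a \<in> carrier F. \<phi> (v \<bullet>\<^bsub>V\<^esub> a) = \<phi> v \<bullet>\<^bsub>V\<^esub> a)}"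

definition is_adjoint ::
    "('f, 'm) star_ring_scheme \<Rightarrow> ('f, 'v, 'n) inner_space_scheme \<Rightarrow> ('v \<Rightarrow> 'v) \<Rightarrow> ('v \<Rightarrow> 'v) \<Rightarrow> bool"
  where "is_adjoint F V \<phi> \<psi> \<longleftrightarrow>
    \<psi> \<in> endomorphisms F V \<and>
    (\<forall>v \<in> carrier V. \<forall>w \<in> carrier V. form V (\<phi> v) w = form V v (\<psi> w))"

definition End_star ::
    "('f, 'm) star_ring_scheme \<Rightarrow> ('f, 'v, 'n) inner_space_scheme \<Rightarrow> ('v \<Rightarrow> 'v) star_ring"
  where "End_star F V =
    \<lparr>carrier = {\<phi> \<in> endomorphisms F V. \<exists>\<psi>. is_adjoint F V \<phi> \<psi>},
     monoid.mult = (\<lambda>\<phi> \<psi>. \<lambda>v \<in> carrier V. \<phi> (\<psi> v)),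
     one = (\<lambda>v \<in> carrier V. v),
     ring.zero = (\<lambda>v \<in> carrier V. \<zero>\<^bsub>V\<^esub>),
     add = (\<lambda>\<phi> \<psi>. \<lambda>v \<in> carrier V. \<phi> v \<oplus>\<^bsub>V\<^esub> \<psi> v),
     invol = (\<lambda>\<phi>. THE \<psi>. is_adjoint F V \<phi> \<psi>)\<rparr>"

lemma (in inner_product_space) is_adjoint_unique:
  assumes 1: "is_adjoint F V \<phi> \<psi>" and 2: "is_adjoint F V \<phi> \<psi>'"
  shows "\<psi> = \<psi>'"
proof -
  have E: "\<psi> \<in> carrier V \<rightarrow>\<^sub>E carrier V" "\<psi>' \<in> carrier V \<rightarrow>\<^sub>E carrier V"
    using 1 2 unfolding is_adjoint_def endomorphisms_def by auto
  have "\<psi> w = \<psi>' w" if w: "w \<in> carrier V" for w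
  proof -
    have c: "\<psi> w \<in> carrier V" "\<psi>' w \<in> carrier V" using E w by auto
    define d where "d = \<psi> w \<ominus>\<^bsub>V\<^esub> \<psi>' w"
    have d: "d \<in> carrier V" using c unfolding d_def by simp
    have eq: "\<psi> w = \<psi>' w \<oplus>\<^bsub>V\<^esub> d"
      using c V.a_lcomm[of "\<psi>' w" "\<psi> w" "\<ominus>\<^bsub>V\<^esub> \<psi>' w"]
      unfolding d_def by (simp add: V.minus_eq V.r_neg)
    have "form V d (\<psi> w) = form V d (\<psi>' w)"
      using 1 2 d w unfolding is_adjoint_def by (metis (no_types))
    moreover have "form V d (\<psi> w) = form V d (\<psi>' w) \<oplus> form V d d"
      by (subst eq) (rule form_add_right[OF d c(2) d])
    ultimately have "form V d (\<psi>' w) \<oplus> form V d d = form V d (\<psi>' w)"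
      by argo
    then have "form V d d = \<zero>"
      using F.add.l_cancel_one[OF form_closed[OF d c(2)] form_closed[OF d d]] by blast
    then have "d = \<zero>\<^bsub>V\<^esub>" using anisotropic d by blast
    with eq show ?thesis using V.r_zero[OF c(2)] by simp
  qed
  then show ?thesis by (rule PiE_ext[OF E])
qed

text \<open>Types cannot be existentially quantified, so the types in which the
  division ring and the vector space are sought are parameters.\<close>

definition representable ::
    "'f itself \<Rightarrow> 'v itself \<Rightarrow> ('a, 'm) star_ring_scheme \<Rightarrow> bool"
  where "representable _ _ R \<longleftrightarrow>
    (\<exists>(F :: 'f star_ring) (V :: ('f, 'v) inner_space) \<rho>.
      inner_product_space F V \<and> star_embedding R (End_star F V) \<rho>)"

end

theory Submission
  imports Defs
begin

text \<open>
  A minimal right ideal of a \<open>*\<close>-regular ring is \<open>eR\<close> for a projection \<open>e\<close>, and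
  then \<open>F = eRe\<close> is a division ring with involution. The left ideal \<open>Re\<close> is an inner product
  space over \<open>F\<close> with \<open>\<langle>v | w\<rangle> = v\<^sup>\<star> w\<close>, anisotropic because the involution is proper, and left
  multiplication represents \<open>R\<close> on it. The least nonzero ideal \<open>M\<close> is not nilpotent by
  regularity, so \<open>R\<close> is prime; hence the representation is faithful and every minimal right
  ideal lies in \<open>M\<close>. Finally, an element of the socle lies in a finite sum of minimal right ideals,
  whose descending chain condition is inherited by the right ideals of the corner; the involution
  yields the condition for left ideals.
\<close>

section \<open>Right ideals and descending chains\<close>

context ring begin

text \<open>Closure under negation need not be checked separately: the negative of \<open>a\<close>
  is \<open>a\<close> times the negative of the unit, so it follows from closure under right
  multiplication.\<close>

lemma right_idealI:
  assumes "I \<subseteq> carrier R" "\<zero> \<in> I"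
    and "\<And>a b. \<lbrakk>a \<in> I; b \<in> I\<rbrakk> \<Longrightarrow> a \<oplus> b \<in> I"
    and "\<And>a x. \<lbrakk>a \<in> I; x \<in> carrier R\<rbrakk> \<Longrightarrow> a \<otimes> x \<in> I"
  shows "right_ideal I R"
proof -
  have "\<ominus> a \<in> I" if "a \<in> I" for a
    using assms(4)[OF that, of "\<ominus> \<one>"] that assms(1) by (auto simp: r_minus)
  then have "additive_subgroup I R"
    using assms(1-3)
    by (auto intro!: additive_subgroup.intro add.subgroupI simp: a_inv_def[symmetric])
  then show ?thesis
    using assms(4) by (simp add: right_ideal_def right_ideal_axioms_def ring_axioms)
qed

lemma right_ideal_subset: "right_ideal I R \<Longrightarrow> I \<subseteq> carrier R"
  by (simp add: right_ideal_def additive_subgroup.a_subset)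

lemma right_ideal_zero: "right_ideal I R \<Longrightarrow> \<zero> \<in> I"
  by (simp add: right_ideal_def additive_subgroup.zero_closed)

lemma right_ideal_add: "\<lbrakk>right_ideal I R; a \<in> I; b \<in> I\<rbrakk> \<Longrightarrow> a \<oplus> b \<in> I"
  by (simp add: right_ideal_def additive_subgroup.a_closed)

lemma right_ideal_minus: "\<lbrakk>right_ideal I R; a \<in> I\<rbrakk> \<Longrightarrow> \<ominus> a \<in> I"
  by (simp add: right_ideal_def additive_subgroup.a_inv_closed)

lemma right_ideal_Int: "\<lbrakk>right_ideal I R; right_ideal J R\<rbrakk> \<Longrightarrow> right_ideal (I \<inter> J) R"
  using right_ideal_subset[of I]
  by (intro right_idealI)
    (auto simp: right_ideal_zero right_ideal_add right_ideal.r_closed)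

lemma ideal_imp_right_ideal: "ideal I R \<Longrightarrow> right_ideal I R"
  by (simp add: right_ideal_def right_ideal_axioms_def ring_axioms ideal_def ideal_axioms_def)

lemma right_ideal_set_add:
  assumes "right_ideal I R" "right_ideal J R"
  shows "right_ideal (I <+>\<^bsub>R\<^esub> J) R"
proof -
  have I: "I \<subseteq> carrier R" and J: "J \<subseteq> carrier R"
    using assms by (simp_all add: right_ideal_subset)
  have sum: "x \<in> I <+>\<^bsub>R\<^esub> J \<longleftrightarrow> (\<exists>i\<in>I. \<exists>j\<in>J. x = i \<oplus> j)" for x
    by (auto simp: set_add_def')
  show ?thesis
  proof (rule right_idealI)
    show "I <+>\<^bsub>R\<^esub> J \<subseteq> carrier R" using I J by (auto simp: sum intro!: a_closed)
    show "\<zero> \<in> I <+>\<^bsub>R\<^esub> J"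
      using assms by (auto simp: sum intro!: bexI[of _ \<zero>] right_ideal_zero)
  next
    fix a b assume "a \<in> I <+>\<^bsub>R\<^esub> J" "b \<in> I <+>\<^bsub>R\<^esub> J"
    then obtain i j i' j' where *: "i \<in> I" "j \<in> J" "i' \<in> I" "j' \<in> J" "a = i \<oplus> j" "b = i' \<oplus> j'"
      by (auto simp: sum)
    then have "a \<oplus> b = (i \<oplus> i') \<oplus> (j \<oplus> j')"
      using I J by (simp add: subset_iff a_ac)
    then show "a \<oplus> b \<in> I <+>\<^bsub>R\<^esub> J"
      unfolding sum using * right_ideal_add[OF assms(1)] right_ideal_add[OF assms(2)] by blast
  next
    fix a x assume "a \<in> I <+>\<^bsub>R\<^esub> J" and x: "x \<in> carrier R"
    then obtain i j where *: "i \<in> I" "j \<in> J" "a = i \<oplus> j"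
      by (auto simp: sum)
    then have "a \<otimes> x = i \<otimes> x \<oplus> j \<otimes> x"
      using I J x by (simp add: subset_iff l_distr)
    then show "a \<otimes> x \<in> I <+>\<^bsub>R\<^esub> J"
      unfolding sum
      using * x right_ideal.r_closed[OF assms(1)] right_ideal.r_closed[OF assms(2)] by blast
  qed
qed

lemma principal_right_ideal:
  assumes "a \<in> carrier R"
  shows "right_ideal {a \<otimes> x | x. x \<in> carrier R} R"
proof (rule right_idealI)
  show "\<zero> \<in> {a \<otimes> x | x. x \<in> carrier R}"
    using assms by (force intro: exI[of _ \<zero>])
  fix b c assume "b \<in> {a \<otimes> x | x. x \<in> carrier R}"
  then obtain x where x: "x \<in> carrier R" "b = a \<otimes> x" by auto
  show "b \<oplus> c \<in> {a \<otimes> x | x. x \<in> carrier R}" if "c \<in> {a \<otimes> x | x. x \<in> carrier R}"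
  proof -
    from that obtain y where "y \<in> carrier R" "c = a \<otimes> y" by auto
    then have "b \<oplus> c = a \<otimes> (x \<oplus> y)" "x \<oplus> y \<in> carrier R"
      using assms x by (simp_all add: r_distr)
    then show ?thesis by blast
  qed
  show "b \<otimes> c \<in> {a \<otimes> x | x. x \<in> carrier R}" if "c \<in> carrier R"
    using assms x that m_assoc by blast
qed (use assms in auto)

text \<open>This is the artinian property of \<open>I\<close> viewed as a right module. The chains
  consist of right ideals of the whole ring lying below \<open>I\<close>, so no module structure on
  \<open>I\<close> itself has to be introduced.\<close>

definition right_dcc_on :: "'a set \<Rightarrow> bool"
  where "right_dcc_on I \<longleftrightarrow>
    (\<forall>C. (\<forall>n::nat. right_ideal (C n) R \<and> C n \<subseteq> I \<and> C (Suc n) \<subseteq> C n) \<longrightarrow>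
      (\<exists>n. \<forall>m\<ge>n. C m = C n))"

lemma right_dcc_onD:
  assumes "right_dcc_on I" "\<And>n::nat. right_ideal (C n) R" "\<And>n. C n \<subseteq> I" "\<And>n. C (Suc n) \<subseteq> C n"
  shows "\<exists>n. \<forall>m\<ge>n. C m = C n"
  using assms unfolding right_dcc_on_def by blast

lemma right_dcc_on_zero: "right_dcc_on {\<zero>}"
proof -
  have "I = {\<zero>}" if "right_ideal I R" "I \<subseteq> {\<zero>}" for I
    using right_ideal_zero[OF that(1)] that(2) by auto
  then show ?thesis
    unfolding right_dcc_on_def by metis
qed

text \<open>Each member of a chain is zero or \<open>I\<close>. Once zero occurs the chain stays
  there by monotonicity; if it never occurs the chain is constantly \<open>I\<close>.\<close>

lemma right_dcc_on_minimal:
  assumes "minimal_right_ideal I R"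
  shows "right_dcc_on I"
  unfolding right_dcc_on_def
proof (intro allI impI)
  fix C :: "nat \<Rightarrow> 'a set"
  assume C: "\<forall>n. right_ideal (C n) R \<and> C n \<subseteq> I \<and> C (Suc n) \<subseteq> C n"
  then have anti: "C m \<subseteq> C n" if "n \<le> m" for m n
    using lift_Suc_antimono_le[of C n m] that by blast
  have zI: "C n = {\<zero>} \<or> C n = I" for n
    using assms C unfolding minimal_right_ideal_def by blast
  show "\<exists>n. \<forall>m\<ge>n. C m = C n"
  proof (cases "\<exists>n. C n = {\<zero>}")
    case True
    then obtain n where n: "C n = {\<zero>}" by blast
    have "C m = C n" if "m \<ge> n" for m
    proof -
      have "\<zero> \<in> C m" using C right_ideal_zero by blast
      then show ?thesis using anti[OF that] n by auto
    qed
    then show ?thesis by blast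
  next
    case False
    then show ?thesis using zI by blast
  qed
qed

text \<open>This is the usual extension argument for artinian modules without quotients. A right
  ideal \<open>C\<close> below \<open>I + J\<close> leaves two traces: \<open>C \<inter> I\<close>,
  and \<open>(C + I) \<inter> J\<close>, which stands in for the image of \<open>C\<close> modulo
  \<open>I\<close>. Nested right ideals with equal traces coincide, so the chain stops when both
  chains of traces have stopped.\<close>

lemma right_dcc_on_set_add:
  assumes I: "right_ideal I R" and J: "right_ideal J R"
    and dccI: "right_dcc_on I" and dccJ: "right_dcc_on J"
  shows "right_dcc_on (I <+>\<^bsub>R\<^esub> J)"
  unfolding right_dcc_on_def
proof (intro allI impI)
  fix C :: "nat \<Rightarrow> 'a set"
  assume C: "\<forall>n. right_ideal (C n) R \<and> C n \<subseteq> I <+>\<^bsub>R\<^esub> J \<and> C (Suc n) \<subseteq> C n"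
  then have anti: "C m \<subseteq> C n" if "n \<le> m" for m n
    using lift_Suc_antimono_le[of C n m] that by blast
  have carr: "I \<subseteq> carrier R" "J \<subseteq> carrier R" "C n \<subseteq> carrier R" for n
    using I J C by (simp_all add: right_ideal_subset)
  have "\<exists>n. \<forall>m\<ge>n. C m \<inter> I = C n \<inter> I"
    by (rule right_dcc_onD[OF dccI]) (use C I right_ideal_Int in auto)
  then obtain n1 where n1: "\<And>m. m \<ge> n1 \<Longrightarrow> C m \<inter> I = C n1 \<inter> I" by blast
  have "\<exists>n. \<forall>m\<ge>n. (C m <+>\<^bsub>R\<^esub> I) \<inter> J = (C n <+>\<^bsub>R\<^esub> I) \<inter> J"
  proof (rule right_dcc_onD[OF dccJ])
    show "(C (Suc n) <+>\<^bsub>R\<^esub> I) \<inter> J \<subseteq> (C n <+>\<^bsub>R\<^esub> I) \<inter> J" for n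
    proof -
      have "C (Suc n) \<subseteq> C n" using C by blast
      then show ?thesis by (auto simp: set_add_def')
    qed
  qed (use C I J right_ideal_Int right_ideal_set_add in auto)
  then obtain n2 where n2: "\<And>m. m \<ge> n2 \<Longrightarrow> (C m <+>\<^bsub>R\<^esub> I) \<inter> J = (C n2 <+>\<^bsub>R\<^esub> I) \<inter> J" by blast
  define n where "n = max n1 n2"
  \<comment> \<open>For x = i + j in \<open>C n\<close>, the summand j = x - i lies in the second
    trace of \<open>C n\<close>, which is that of \<open>C m\<close>; so j = y + i' with y in
    \<open>C m\<close>. Then i + i' = x - y lies in the first trace of \<open>C n\<close>, hence in
    \<open>C m\<close>, and so does x = y + (i + i').\<close>
  have "C n \<subseteq> C m" if m: "m \<ge> n" for m
  proof
    fix x assume x: "x \<in> C n"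
    then obtain i j where ij: "i \<in> I" "j \<in> J" "x = i \<oplus> j"
      using C by (force simp: set_add_def')
    then have cc: "x \<in> carrier R" "i \<in> carrier R" "j \<in> carrier R"
      using x carr by auto
    have "j = x \<oplus> (\<ominus> i)"
      using ij cc by (metis a_comm r_neg1 a_inv_closed)
    then have "j \<in> (C n <+>\<^bsub>R\<^esub> I) \<inter> J"
      using x ij right_ideal_minus[OF I] by (auto simp: set_add_def')
    also have "\<dots> = (C m <+>\<^bsub>R\<^esub> I) \<inter> J"
      using n2[of n] n2[of m] m by (simp add: n_def)
    finally obtain y i' where y: "y \<in> C m" "i' \<in> I" "j = y \<oplus> i'"
      by (auto simp: set_add_def')
    then have cc': "y \<in> carrier R" "i' \<in> carrier R" using carr by auto
    have xy: "x = y \<oplus> (i \<oplus> i')"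
      using ij y cc cc' by (simp add: a_ac)
    have "i \<oplus> i' = x \<oplus> (\<ominus> y)"
      using xy cc cc' by (metis a_comm r_neg1 a_inv_closed a_closed)
    moreover have "y \<in> C n" using y anti[OF m] by blast
    ultimately have "i \<oplus> i' \<in> C n"
      using x C right_ideal_add right_ideal_minus by metis
    moreover have "i \<oplus> i' \<in> I" using ij y I right_ideal_add by blast
    ultimately have "i \<oplus> i' \<in> C m"
      using n1[of n] n1[of m] m by (auto simp: n_def)
    then show "x \<in> C m"
      using xy y C right_ideal_add by metis
  qed
  then have "\<forall>m\<ge>n. C m = C n" using anti by blast
  then show "\<exists>n. \<forall>m\<ge>n. C m = C n" by blast
qed


section \<open>The socle\<close>

lemma socle_subset: "socle R \<subseteq> carrier R"
  unfolding socle_def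
  by (rule add.generate_incl) (auto simp: minimal_right_ideal_def dest: right_ideal_subset)

lemma socle_zero: "\<zero> \<in> socle R"
  using generate.one[of "add_monoid R"] unfolding socle_def by simp

lemma socle_add: "\<lbrakk>a \<in> socle R; b \<in> socle R\<rbrakk> \<Longrightarrow> a \<oplus> b \<in> socle R"
  using generate.eng[of _ "add_monoid R"] unfolding socle_def by force

lemma minimal_subset_socle: "minimal_right_ideal I R \<Longrightarrow> I \<subseteq> socle R"
  unfolding socle_def by (auto intro: generate.incl)

text \<open>The generated subgroup also has a case for inverses. It is absorbed into the case
  \<open>minimal\<close>, because a minimal right ideal contains the negatives of its
  elements.\<close>

lemma socle_induct [consumes 1, case_names zero minimal add]:
  assumes "a \<in> socle R" "P \<zero>"
    and minimal: "\<And>I b. \<lbrakk>minimal_right_ideal I R; b \<in> I\<rbrakk> \<Longrightarrow> P b"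
    and add: "\<And>b c. \<lbrakk>b \<in> socle R; P b; c \<in> socle R; P c\<rbrakk> \<Longrightarrow> P (b \<oplus> c)"
  shows "P a"
  using assms(1) unfolding socle_def
proof (induction rule: generate.induct)
  case one
  then show ?case using assms(2) by simp
next
  case (incl h)
  then show ?case using minimal by blast
next
  case (inv h)
  then obtain I where "minimal_right_ideal I R" "h \<in> I" by blast
  then show ?case
    using minimal[of I "\<ominus> h"] right_ideal_minus
    by (simp add: minimal_right_ideal_def a_inv_def)
next
  case (eng h1 h2)
  then show ?case using add by (simp add: socle_def)
qed

text \<open>Left multiplication by \<open>r\<close> is a homomorphism of right modules. A right
  ideal \<open>J\<close> inside the image of \<open>I\<close> is the image of its preimage in
  \<open>I\<close>, and by minimality that preimage is zero or all of \<open>I\<close>.\<close>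

lemma left_multiple_minimal:
  assumes min: "minimal_right_ideal I R" and r: "r \<in> carrier R"
  shows "(\<lambda>x. r \<otimes> x) ` I = {\<zero>} \<or> minimal_right_ideal ((\<lambda>x. r \<otimes> x) ` I) R"
proof -
  let ?rI = "(\<lambda>x. r \<otimes> x) ` I"
  have I: "right_ideal I R" using min by (simp add: minimal_right_ideal_def)
  note carr = right_ideal_subset[OF I]
  have rI: "right_ideal ?rI R"
  proof (rule right_idealI)
    show "?rI \<subseteq> carrier R" using carr r by auto
    show "\<zero> \<in> ?rI" using right_ideal_zero[OF I] r by force
  next
    fix a b assume "a \<in> ?rI" "b \<in> ?rI"
    then obtain x y where xy: "x \<in> I" "y \<in> I" "a = r \<otimes> x" "b = r \<otimes> y" by auto
    then have "a \<oplus> b = r \<otimes> (x \<oplus> y)" using carr r by (simp add: subset_iff r_distr)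
    then show "a \<oplus> b \<in> ?rI" using right_ideal_add[OF I] xy by blast
  next
    fix a y assume "a \<in> ?rI" and y: "y \<in> carrier R"
    then obtain x where x: "x \<in> I" "a = r \<otimes> x" by auto
    then have "a \<otimes> y = r \<otimes> (x \<otimes> y)" using carr r y by (simp add: subset_iff m_assoc)
    then show "a \<otimes> y \<in> ?rI" using right_ideal.r_closed[OF I x(1) y] by blast
  qed
  moreover have "J = {\<zero>} \<or> J = ?rI" if J: "right_ideal J R" and JI: "J \<subseteq> ?rI" for J
  proof -
    let ?J = "{x \<in> I. r \<otimes> x \<in> J}"
    have "right_ideal ?J R"
    proof (rule right_idealI)
      show "?J \<subseteq> carrier R" using carr by auto
      show "\<zero> \<in> ?J" using right_ideal_zero[OF I] right_ideal_zero[OF J] r by simp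
    next
      fix a b assume "a \<in> ?J" "b \<in> ?J"
      then show "a \<oplus> b \<in> ?J"
        using right_ideal_add[OF I] right_ideal_add[OF J] carr r by (simp add: subset_iff r_distr)
    next
      fix a y assume "a \<in> ?J" and y: "y \<in> carrier R"
      then have a: "a \<in> I" "a \<in> carrier R" "r \<otimes> a \<in> J" using carr by auto
      have "r \<otimes> (a \<otimes> y) = r \<otimes> a \<otimes> y" using a r y by (simp add: m_assoc)
      then show "a \<otimes> y \<in> ?J"
        using right_ideal.r_closed[OF I a(1) y] right_ideal.r_closed[OF J a(3) y] by simp
    qed
    then have "?J = {\<zero>} \<or> ?J = I"
      using min unfolding minimal_right_ideal_def by blast
    moreover have "J = (\<lambda>x. r \<otimes> x) ` ?J" using JI by blast
    ultimately show ?thesis using r by auto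
  qed
  ultimately show ?thesis by (auto simp: minimal_right_ideal_def)
qed

text \<open>Right multiplication preserves each minimal right ideal; left multiplication sends it to
  zero or to another minimal right ideal. Additivity extends both facts to the whole socle.\<close>

lemma socle_ideal: "ideal (socle R) R"
proof -
  have right: "a \<otimes> x \<in> socle R" if "a \<in> socle R" and x: "x \<in> carrier R" for a x
    using that(1)
  proof (induction rule: socle_induct)
    case zero
    then show ?case using x socle_zero by simp
  next
    case (minimal I b)
    then show ?case
      using x minimal_subset_socle right_ideal.r_closed[of I R b x]
      by (auto simp: minimal_right_ideal_def)
  next
    case (add b c)
    then show ?case using x socle_add socle_subset by (simp add: l_distr subset_iff)
  qed
  have left: "x \<otimes> a \<in> socle R" if "a \<in> socle R" and x: "x \<in> carrier R" for a x
    using that(1)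
  proof (induction rule: socle_induct)
    case zero
    then show ?case using x socle_zero by simp
  next
    case (minimal I b)
    let ?xI = "(\<lambda>y. x \<otimes> y) ` I"
    have b: "x \<otimes> b \<in> ?xI" using minimal(2) by (rule imageI)
    from left_multiple_minimal[OF minimal(1) x] show ?case
    proof
      assume "?xI = {\<zero>}"
      then show ?case using b socle_zero by simp
    next
      assume "minimal_right_ideal ?xI R"
      then show ?case using b by (rule subsetD[OF minimal_subset_socle])
    qed
  next
    case (add b c)
    then show ?case using x socle_add socle_subset by (simp add: r_distr subset_iff)
  qed
  have "right_ideal (socle R) R"
    by (rule right_idealI) (use socle_subset socle_zero socle_add right in auto)
  then have "additive_subgroup (socle R) R" by (simp add: right_ideal_def)
  then show ?thesis
    using left right by (simp add: ideal_def ideal_axioms_def ring_axioms)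
qed

text \<open>The right ideal obtained is a finite sum of minimal ones. Building it along the
  induction keeps the finite index family implicit.\<close>

lemma socle_dcc:
  assumes "a \<in> socle R"
  shows "\<exists>I. right_ideal I R \<and> a \<in> I \<and> right_dcc_on I"
  using assms
proof (induction rule: socle_induct)
  case zero
  have "right_ideal {\<zero>} R" by (rule right_idealI) auto
  then show ?case using right_dcc_on_zero by blast
next
  case (minimal I b)
  then show ?case using right_dcc_on_minimal by (auto simp: minimal_right_ideal_def)
next
  case (add b c)
  then obtain I J where "right_ideal I R" "b \<in> I" "right_dcc_on I"
      "right_ideal J R" "c \<in> J" "right_dcc_on J" by blast
  moreover from this have "b \<oplus> c \<in> I <+>\<^bsub>R\<^esub> J" by (auto simp: set_add_def')
  ultimately show ?case using right_ideal_set_add right_dcc_on_set_add by blast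
qed

lemma minimal_right_ideal_ex:
  assumes "socle R \<noteq> {\<zero>}"
  obtains I where "minimal_right_ideal I R"
proof -
  have "\<exists>I. minimal_right_ideal I R"
  proof (rule ccontr)
    assume none: "\<nexists>I. minimal_right_ideal I R"
    have "a = \<zero>" if "a \<in> socle R" for a
      using that by (induction rule: socle_induct) (use none in auto)
    then show False using assms socle_zero by blast
  qed
  then show ?thesis using that by blast
qed


section \<open>Corners\<close>

text \<open>Describing the corner by the equations ex = x = xe makes membership a matter of
  simplification, whereas the form ere requires finding a witness r each time.\<close>

lemma carrier_corner:
  assumes "e \<in> carrier R" "e \<otimes> e = e"
  shows "carrier (corner R e) = {x \<in> carrier R. e \<otimes> x = x \<and> x \<otimes> e = x}"
proof (intro equalityI subsetI)
  fix x assume "x \<in> carrier (corner R e)"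
  then obtain r where r: "r \<in> carrier R" "x = e \<otimes> r \<otimes> e" by (auto simp: corner_def)
  moreover have "e \<otimes> (e \<otimes> r \<otimes> e) = (e \<otimes> e) \<otimes> r \<otimes> e"
    using assms(1) r(1) by (simp only: m_assoc m_closed)
  moreover have "(e \<otimes> r \<otimes> e) \<otimes> e = e \<otimes> r \<otimes> (e \<otimes> e)"
    using assms(1) r(1) by (simp only: m_assoc m_closed)
  ultimately show "x \<in> {x \<in> carrier R. e \<otimes> x = x \<and> x \<otimes> e = x}"
    using assms by simp
next
  fix x assume "x \<in> {x \<in> carrier R. e \<otimes> x = x \<and> x \<otimes> e = x}"
  then have "x \<in> carrier R" "x = e \<otimes> x \<otimes> e" by auto
  then show "x \<in> carrier (corner R e)" by (auto simp: corner_def)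
qed

lemma corner_simps [simp]:
  "x \<otimes>\<^bsub>corner R e\<^esub> y = x \<otimes> y" "x \<oplus>\<^bsub>corner R e\<^esub> y = x \<oplus> y"
  "\<zero>\<^bsub>corner R e\<^esub> = \<zero>" "\<one>\<^bsub>corner R e\<^esub> = e"
  by (simp_all add: corner_def)

lemma ring_corner:
  assumes "e \<in> carrier R" "e \<otimes> e = e"
  shows "ring (corner R e)"
proof (rule ringI)
  note [simp] = carrier_corner[OF assms] assms
  show "abelian_group (corner R e)"
  proof (rule abelian_groupI)
    fix x assume x: "x \<in> carrier (corner R e)"
    then have "\<ominus> x \<in> carrier (corner R e)" by (auto simp: r_minus l_minus)
    then show "\<exists>y \<in> carrier (corner R e). y \<oplus>\<^bsub>corner R e\<^esub> x = \<zero>\<^bsub>corner R e\<^esub>"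
      using x l_neg by auto
  qed (auto simp: l_distr r_distr a_ac)
  show "monoid (corner R e)"
  proof (rule monoidI)
    fix x y assume "x \<in> carrier (corner R e)" "y \<in> carrier (corner R e)"
    then show "x \<otimes>\<^bsub>corner R e\<^esub> y \<in> carrier (corner R e)"
      by (simp add: m_assoc) (simp add: m_assoc[symmetric])
  qed (auto simp: m_assoc)
qed (auto simp: carrier_corner[OF assms] l_distr r_distr)

text \<open>The chain in the corner is lifted to right ideals \<open>K n\<close> of
  \<open>R\<close>. They lie in \<open>I\<close>, since x = ex and e belongs to \<open>I\<close>, so
  they become stationary. The lift loses nothing: \<open>C n\<close> is recovered from
  \<open>K n\<close> as the elements x with xe = x.\<close>

lemma corner_right_dcc:
  assumes e: "e \<in> carrier R" "e \<otimes> e = e" and soc: "e \<in> socle R"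
    and C: "\<And>n::nat. right_ideal (C n) (corner R e)" and dec: "\<And>n. C (Suc n) \<subseteq> C n"
  shows "\<exists>n. \<forall>m\<ge>n. C m = C n"
proof -
  interpret S: ring "corner R e" by (rule ring_corner[OF e])
  note carr = carrier_corner[OF e]
  have Ccarr: "x \<in> carrier R \<and> e \<otimes> x = x \<and> x \<otimes> e = x" if "x \<in> C n" for x n
    using S.right_ideal_subset[OF C] that carr by auto
  obtain I where I: "right_ideal I R" "e \<in> I" "right_dcc_on I"
    using socle_dcc[OF soc] by blast
  \<comment> \<open>the largest right ideal of \<open>R\<close> inside \<open>eR\<close> that meets the corner in \<open>C n\<close>\<close>
  define K where
    "K n = {x \<in> carrier R. e \<otimes> x = x \<and> (\<forall>r \<in> carrier R. x \<otimes> r \<otimes> e \<in> C n)}" for n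
  have CK: "C n = {x \<in> K n. x \<otimes> e = x}" for n
  proof (intro equalityI subsetI)
    fix x assume x: "x \<in> C n"
    have xc: "x \<in> carrier R" "e \<otimes> x = x" "x \<otimes> e = x" using Ccarr[OF x] by auto
    \<comment> \<open>Since x = xe, multiplying by r and then by e amounts to multiplying by ere, an
      element of the corner, under which \<open>C n\<close> is closed.\<close>
    have "x \<otimes> r \<otimes> e \<in> C n" if r: "r \<in> carrier R" for r
    proof -
      have "x \<otimes> r \<otimes> e = (x \<otimes> e) \<otimes> r \<otimes> e" using xc by simp
      also have "\<dots> = x \<otimes> (e \<otimes> r \<otimes> e)" using xc(1) e(1) r by (simp only: m_assoc m_closed)
      finally have eq: "x \<otimes> r \<otimes> e = x \<otimes> (e \<otimes> r \<otimes> e)" .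
      have "e \<otimes> r \<otimes> e \<in> carrier (corner R e)" using r by (auto simp: corner_def)
      then show ?thesis
        unfolding eq using right_ideal.r_closed[OF C x] by simp
    qed
    then show "x \<in> {x \<in> K n. x \<otimes> e = x}" using xc by (auto simp: K_def)
  next
    fix x assume "x \<in> {x \<in> K n. x \<otimes> e = x}"
    \<comment> \<open>The defining condition of \<open>K n\<close> is used with the unit of
      \<open>R\<close> in place of r.\<close>
    then have "x \<in> carrier R" "x \<otimes> e = x" "x \<otimes> \<one> \<otimes> e \<in> C n"
      unfolding K_def by blast+
    then show "x \<in> C n" by simp
  qed
  have "\<exists>n. \<forall>m\<ge>n. K m = K n"
  proof (rule right_dcc_onD[OF I(3)])
    fix n
    show "right_ideal (K n) R"
    proof (rule right_idealI)
      show "K n \<subseteq> carrier R" by (auto simp: K_def)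
      show "\<zero> \<in> K n" using e S.right_ideal_zero[OF C] by (simp add: K_def)
    next
      fix a b assume "a \<in> K n" "b \<in> K n"
      then show "a \<oplus> b \<in> K n"
        using e S.right_ideal_add[OF C] by (simp add: K_def r_distr l_distr)
    next
      fix a x assume "a \<in> K n" and x: "x \<in> carrier R"
      then have a: "a \<in> carrier R" "e \<otimes> a = a" "\<And>r. r \<in> carrier R \<Longrightarrow> a \<otimes> r \<otimes> e \<in> C n"
        by (auto simp: K_def)
      have "e \<otimes> (a \<otimes> x) = a \<otimes> x" using a x e m_assoc[of e a x] by simp
      moreover have "a \<otimes> x \<otimes> r \<otimes> e \<in> C n" if "r \<in> carrier R" for r
        using a(3)[of "x \<otimes> r"] a(1) x that m_assoc[of a x r] by simp
      ultimately show "a \<otimes> x \<in> K n" using a x by (simp add: K_def)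
    qed
    show "K n \<subseteq> I"
    proof
      fix x assume "x \<in> K n"
      then show "x \<in> I" using right_ideal.r_closed[OF I(1,2), of x] by (simp add: K_def)
    qed
    show "K (Suc n) \<subseteq> K n" using dec unfolding K_def by blast
  qed
  then obtain n where n: "\<And>m. m \<ge> n \<Longrightarrow> K m = K n" by blast
  have "C m = C n" if "m \<ge> n" for m
    by (simp only: CK n[OF that])
  then show ?thesis by blast
qed

end

section \<open>Primeness of subdirectly irreducible regular rings, and the socle as least nonzero
  ideal\<close>

context regular_ring begin

text \<open>If aRb = 0, then two annihilator ideals, one containing \<open>a\<close> and the other
  \<open>b\<close>, are both nonzero and thus contain the least ideal \<open>M\<close>. Together
  they give MM = 0, which regularity forbids.\<close>

lemma subdirectly_irreducible_prime:
  assumes si: "subdirectly_irreducible R"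
    and a: "a \<in> carrier R" "a \<noteq> \<zero>" and b: "b \<in> carrier R" "b \<noteq> \<zero>"
  shows "\<exists>r \<in> carrier R. a \<otimes> r \<otimes> b \<noteq> \<zero>"
proof (rule ccontr)
  assume "\<not> ?thesis"
  then have ab: "a \<otimes> r \<otimes> b = \<zero>" if "r \<in> carrier R" for r using that by blast
  define M where "M = minimal_ideal R"
  have "least_nonzero_ideal M R"
    using least_nonzero_ideal_minimal_ideal[OF si] by (simp add: M_def)
  then have M: "ideal M R" "M \<noteq> {\<zero>}" and least: "\<And>I. \<lbrakk>ideal I R; I \<noteq> {\<zero>}\<rbrakk> \<Longrightarrow> M \<subseteq> I"
    by (auto simp: least_nonzero_ideal_def)
  interpret M: ideal M R by (rule M)
  \<comment> \<open>This is the left annihilator of the left ideal Rb, hence two-sided; it contains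
    \<open>a\<close>.\<close>
  define L where "L = {x \<in> carrier R. \<forall>r \<in> carrier R. x \<otimes> r \<otimes> b = \<zero>}"
  have "ideal L R"
  proof (rule idealI)
    show "subgroup L (add_monoid R)"
      using b by (auto intro!: add.subgroupI simp: L_def l_distr l_minus a_inv_def[symmetric])
  next
    fix x y assume x: "x \<in> L" and y: "y \<in> carrier R"
    then have "x \<in> carrier R" by (simp add: L_def)
    with x y b show "y \<otimes> x \<in> L" by (simp add: L_def m_assoc)
    have "x \<otimes> (y \<otimes> r) \<otimes> b = \<zero>" if "r \<in> carrier R" for r
      using x y that unfolding L_def by blast
    then show "x \<otimes> y \<in> L" using \<open>x \<in> carrier R\<close> y b by (simp add: L_def m_assoc)
  qed (rule ring_axioms)
  moreover have "a \<in> L" using a ab by (simp add: L_def)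
  ultimately have M_sub_L: "M \<subseteq> L" using least a by blast
  \<comment> \<open>This is the right annihilator of \<open>M\<close>, two-sided because
    \<open>M\<close> is. As \<open>M\<close> lies in \<open>L\<close>, it annihilates
    \<open>b\<close>, so \<open>b\<close> belongs to \<open>N\<close>.\<close>
  define N where "N = {y \<in> carrier R. \<forall>x \<in> M. x \<otimes> y = \<zero>}"
  have "ideal N R"
  proof (rule idealI)
    show "subgroup N (add_monoid R)"
      using M.Icarr by (auto intro!: add.subgroupI simp: N_def r_distr r_minus a_inv_def[symmetric])
  next
    fix x y assume x: "x \<in> N" and y: "y \<in> carrier R"
    then have xc: "x \<in> carrier R" by (simp add: N_def)
    have "z \<otimes> (y \<otimes> x) = \<zero>" if z: "z \<in> M" for z
    proof -
      have "z \<otimes> y \<in> M" using z y M.I_r_closed by blast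
      then have "z \<otimes> y \<otimes> x = \<zero>" using x by (simp add: N_def)
      then show ?thesis using M.Icarr[OF z] y xc by (simp add: m_assoc)
    qed
    then show "y \<otimes> x \<in> N" using xc y by (simp add: N_def)
    have "z \<otimes> (x \<otimes> y) = \<zero>" if z: "z \<in> M" for z
      using M.Icarr[OF z] x xc y z by (simp add: N_def m_assoc[symmetric])
    then show "x \<otimes> y \<in> N" using xc y by (simp add: N_def)
  qed (rule ring_axioms)
  moreover have "x \<otimes> b = \<zero>" if "x \<in> M" for x
  proof -
    have "x \<otimes> \<one> \<otimes> b = \<zero>" using that M_sub_L one_closed unfolding L_def by blast
    then show ?thesis using M.Icarr[OF that] by simp
  qed
  then have "b \<in> N" using b by (simp add: N_def)
  ultimately have M_sub_N: "M \<subseteq> N" using least b by blast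
  \<comment> \<open>In m = (mx)m the left factor lies in \<open>M\<close> and the right factor in
    \<open>N\<close>, so the product vanishes.\<close>
  have "m = \<zero>" if m: "m \<in> M" for m
  proof -
    obtain x where x: "x \<in> carrier R" "m \<otimes> x \<otimes> m = m" using regular M.Icarr[OF m] by blast
    have "m \<otimes> x \<in> M" using m x M.I_r_closed by blast
    then show "m = \<zero>" using M_sub_N m x by (auto simp: N_def)
  qed
  then show False using M.zero_closed M(2) by blast
qed

text \<open>The least ideal lies in the socle because the socle is a nonzero ideal. Conversely,
  primeness produces a nonzero element arm in the intersection of a minimal right ideal with
  \<open>M\<close>; by minimality that right ideal lies in \<open>M\<close>.\<close>

lemma socle_eq_minimal_ideal:
  assumes si: "subdirectly_irreducible R" and soc: "socle R \<noteq> {\<zero>}"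
  shows "socle R = minimal_ideal R"
proof
  define M where "M = minimal_ideal R"
  have "least_nonzero_ideal M R"
    using least_nonzero_ideal_minimal_ideal[OF si] by (simp add: M_def)
  then have M: "ideal M R" "M \<noteq> {\<zero>}" and least: "\<And>I. \<lbrakk>ideal I R; I \<noteq> {\<zero>}\<rbrakk> \<Longrightarrow> M \<subseteq> I"
    by (auto simp: least_nonzero_ideal_def)
  interpret M: ideal M R by (rule M)
  show "minimal_ideal R \<subseteq> socle R" using least[OF socle_ideal soc] by (simp add: M_def)
  obtain m where m: "m \<in> M" "m \<noteq> \<zero>" using M(2) M.zero_closed by blast
  have IM: "I \<subseteq> M" if min: "minimal_right_ideal I R" for I
  proof -
    have I: "right_ideal I R" "I \<noteq> {\<zero>}" using min by (auto simp: minimal_right_ideal_def)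
    then obtain a where a: "a \<in> I" "a \<noteq> \<zero>" using right_ideal_zero by blast
    have ac: "a \<in> carrier R" using a right_ideal_subset[OF I(1)] by blast
    obtain r where r: "r \<in> carrier R" "a \<otimes> r \<otimes> m \<noteq> \<zero>"
      using subdirectly_irreducible_prime[OF si ac a(2) M.Icarr[OF m(1)] m(2)] by blast
    have "a \<otimes> r \<otimes> m \<in> I \<inter> M"
      using r a m ac M.Icarr[OF m(1)] right_ideal.r_closed[OF I(1)] M.I_l_closed by simp
    moreover have "right_ideal (I \<inter> M) R"
      by (intro right_ideal_Int I ideal_imp_right_ideal M)
    then have "I \<inter> M = {\<zero>} \<or> I \<inter> M = I" using min unfolding minimal_right_ideal_def by blast
    ultimately show ?thesis using r by blast
  qed
  show "socle R \<subseteq> minimal_ideal R"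
  proof
    fix x assume "x \<in> socle R"
    then have "x \<in> M"
      by (induction rule: socle_induct) (use IM in auto)
    then show "x \<in> minimal_ideal R" by (simp add: M_def)
  qed
qed

end


section \<open>Involutions and projections\<close>

context star_ring begin

lemma invol_zero [simp]: "\<zero>\<^sup>\<star> = \<zero>"
proof -
  have "\<zero>\<^sup>\<star> \<oplus> \<zero>\<^sup>\<star> = \<zero>\<^sup>\<star>" using invol_add[of \<zero> \<zero>] by simp
  then show ?thesis using add.l_cancel_one[of "\<zero>\<^sup>\<star>" "\<zero>\<^sup>\<star>"] by (simp add: invol_closed)
qed

lemma invol_minus: "a \<in> carrier R \<Longrightarrow> (\<ominus> a)\<^sup>\<star> = \<ominus> (a\<^sup>\<star>)"
  by (metis a_inv_closed invol_add invol_closed invol_zero minus_equality l_neg)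

lemma star_ring_corner:
  assumes "projection R e"
  shows "star_ring (corner R e)"
proof -
  have e: "e \<in> carrier R" "e \<otimes> e = e" "e\<^sup>\<star> = e" using assms by (auto simp: projection_def)
  have inv: "x\<^sup>\<star>\<^bsub>corner R e\<^esub> = x\<^sup>\<star>" for x by (simp add: corner_def)
  show ?thesis
  proof (intro star_ring.intro star_ring_axioms.intro)
    show "ring (corner R e)" by (rule ring_corner[OF e(1,2)])
    show "a\<^sup>\<star>\<^bsub>corner R e\<^esub> \<in> carrier (corner R e)" if "a \<in> carrier (corner R e)" for a
      using that e invol_mult[of e a] invol_mult[of a e]
      by (auto simp: carrier_corner[OF e(1,2)] inv invol_closed)
  qed (auto simp: carrier_corner[OF e(1,2)] inv invol_add invol_mult invol_invol)
qed

text \<open>Only the right-hand chain condition is proved directly. As \<open>e\<close> is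
  self-adjoint, the involution restricts to the corner, where it turns left ideals into right ideals
  and so transfers the condition.\<close>

lemma artinian_corner:
  assumes proj: "projection R e" and soc: "e \<in> socle R"
  shows "artinian_ring (corner R e)"
proof -
  have e: "e \<in> carrier R" "e \<otimes> e = e" using proj by (auto simp: projection_def)
  interpret S: star_ring "corner R e" by (rule star_ring_corner[OF proj])
  have left: "\<exists>n. \<forall>m\<ge>n. C m = C n"
    if C: "\<And>n::nat. left_ideal (C n) (corner R e)" and dec: "\<And>n. C (Suc n) \<subseteq> C n" for C
  proof -
    \<comment> \<open>The image of \<open>C n\<close> under the involution, written as a preimage;
      since the involution is its own inverse, the same formula recovers \<open>C n\<close> from
      \<open>D n\<close>.\<close>
    define D where "D n = {x \<in> carrier (corner R e). x\<^sup>\<star>\<^bsub>corner R e\<^esub> \<in> C n}" for n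
    have sub: "additive_subgroup (C n) (corner R e)" for n using C by (simp add: left_ideal_def)
    have CD: "C n = {x \<in> carrier (corner R e). x\<^sup>\<star>\<^bsub>corner R e\<^esub> \<in> D n}" for n
    proof -
      have "x \<in> carrier (corner R e)" if "x \<in> C n" for x
        using additive_subgroup.a_subset[OF sub] that by blast
      then show ?thesis
        using S.invol_closed S.invol_invol unfolding D_def by auto
    qed
    have "\<exists>n. \<forall>m\<ge>n. D m = D n"
    proof (rule corner_right_dcc[OF e soc])
      fix n
      show "right_ideal (D n) (corner R e)"
      proof (rule S.right_idealI)
        show "\<zero>\<^bsub>corner R e\<^esub> \<in> D n"
          using additive_subgroup.zero_closed[OF sub] S.invol_zero S.zero_closed
          unfolding D_def by simp
      next
        fix a b assume "a \<in> D n" "b \<in> D n"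
        then show "a \<oplus>\<^bsub>corner R e\<^esub> b \<in> D n"
          using additive_subgroup.a_closed[OF sub] S.invol_add S.a_closed
          unfolding D_def by simp
      next
        fix a x assume "a \<in> D n" "x \<in> carrier (corner R e)"
        then show "a \<otimes>\<^bsub>corner R e\<^esub> x \<in> D n"
          using left_ideal.l_closed[OF C] S.invol_mult S.m_closed S.invol_closed
          unfolding D_def by simp
      qed (auto simp: D_def)
      show "D (Suc n) \<subseteq> D n" using dec by (auto simp: D_def)
    qed
    then obtain n where n: "\<And>m. m \<ge> n \<Longrightarrow> D m = D n" by blast
    have "C m = C n" if "m \<ge> n" for m
      by (simp only: CD n[OF that])
    then show ?thesis by blast
  qed
  show ?thesis
    by (intro artinian_ring.intro artinian_ring_axioms.intro S.ring_axioms)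
      (use corner_right_dcc[OF e soc] left in blast)+
qed

end

section \<open>Projections generating principal and minimal right ideals\<close>

context star_regular_ring begin

text \<open>Every principal right ideal \<open>aR\<close> is generated by the projection \<open>a z a\<^sup>\<star>\<close> where \<open>z\<close> is a
  self-adjoint reflexive inverse of \<open>a\<^sup>\<star> a\<close>.\<close>

lemma range_projection:
  assumes a: "a \<in> carrier R"
  obtains e x where "projection R e" "e \<otimes> a = a" "x \<in> carrier R" "e = a \<otimes> x"
proof -
  define q where "q = a\<^sup>\<star> \<otimes> a"
  have as: "a\<^sup>\<star> \<in> carrier R" and q: "q \<in> carrier R" and qs: "q\<^sup>\<star> = q"
    using a by (auto simp: q_def invol_mult invol_closed invol_invol)
  obtain y where y: "y \<in> carrier R" "q \<otimes> y \<otimes> q = q" using regular[OF q] by blast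
  have ys: "y\<^sup>\<star> \<in> carrier R" using y by (simp add: invol_closed)
  \<comment> \<open>Applying the involution to qyq = q, with \<open>q\<close> self-adjoint, shows
    that the adjoint of \<open>y\<close> is an inner inverse of \<open>q\<close> as well.\<close>
  have ysq: "q \<otimes> y\<^sup>\<star> \<otimes> q = q"
  proof -
    have "(q \<otimes> y \<otimes> q)\<^sup>\<star> = q \<otimes> y\<^sup>\<star> \<otimes> q"
      using q y(1) ys by (simp add: invol_mult qs m_assoc)
    then show ?thesis using y qs by simp
  qed
  \<comment> \<open>Placing \<open>q\<close> between the inner inverse \<open>y\<close> and its
    adjoint yields an inner inverse that is self-adjoint and also satisfies zqz = z.\<close>
  define z where "z = y \<otimes> q \<otimes> y\<^sup>\<star>"
  have z: "z \<in> carrier R" using y q ys by (simp add: z_def)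
  have zs: "z\<^sup>\<star> = z" using y q ys by (simp add: z_def invol_mult invol_invol qs m_assoc)
  have qzq: "q \<otimes> z \<otimes> q = q"
  proof -
    have "q \<otimes> z \<otimes> q = (q \<otimes> y \<otimes> q) \<otimes> y\<^sup>\<star> \<otimes> q"
      unfolding z_def using q y(1) ys by (simp only: m_assoc m_closed)
    then show ?thesis by (simp only: y(2) ysq)
  qed
  have zqz: "z \<otimes> q \<otimes> z = z"
  proof -
    have "z \<otimes> q \<otimes> z = y \<otimes> (q \<otimes> y\<^sup>\<star> \<otimes> q) \<otimes> y \<otimes> q \<otimes> y\<^sup>\<star>"
      unfolding z_def using q y(1) ys by (simp only: m_assoc m_closed)
    also have "\<dots> = y \<otimes> (q \<otimes> y \<otimes> q) \<otimes> y\<^sup>\<star>"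
      unfolding ysq using q y(1) ys by (simp only: m_assoc m_closed)
    finally show ?thesis by (simp only: y(2) z_def)
  qed
  define e where "e = a \<otimes> z \<otimes> a\<^sup>\<star>"
  have e: "e \<in> carrier R" using a as z by (simp add: e_def)
  have es: "e\<^sup>\<star> = e" using a as z by (simp add: e_def invol_mult invol_invol zs m_assoc)
  have ee: "e \<otimes> e = e"
  proof -
    have "e \<otimes> e = a \<otimes> (z \<otimes> q \<otimes> z) \<otimes> a\<^sup>\<star>"
      unfolding e_def q_def using a as z by (simp only: m_assoc m_closed)
    then show ?thesis by (simp only: zqz e_def)
  qed
  \<comment> \<open>The defect d = a - ea is killed from the left by \<open>e\<close> and by
    \<open>a\<^sup>\<star>\<close>, hence also by \<open>d\<^sup>\<star>\<close>, which is
    \<open>a\<^sup>\<star>\<close> minus \<open>a\<^sup>\<star>\<close> times e. Properness, applied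
    to \<open>d\<^sup>\<star>\<close>, then forces d = 0.\<close>
  have "a \<ominus> e \<otimes> a = \<zero>"
  proof -
    define d where "d = a \<ominus> e \<otimes> a"
    have d: "d \<in> carrier R" "d\<^sup>\<star> \<in> carrier R" using a e by (auto simp: d_def invol_closed)
    have ed: "e \<otimes> d = \<zero>"
      using a e ee m_assoc[of e e a] by (simp add: d_def minus_eq r_distr r_minus r_neg)
    have qd: "a\<^sup>\<star> \<otimes> d = \<zero>"
    proof -
      have "a\<^sup>\<star> \<otimes> (e \<otimes> a) = q \<otimes> z \<otimes> q"
        unfolding e_def q_def using a as z by (simp only: m_assoc m_closed)
      then have "a\<^sup>\<star> \<otimes> (e \<otimes> a) = a\<^sup>\<star> \<otimes> a" by (simp only: qzq) (simp only: q_def)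
      then show ?thesis using a as e by (simp add: d_def minus_eq r_distr r_minus r_neg)
    qed
    have ds: "d\<^sup>\<star> = a\<^sup>\<star> \<ominus> a\<^sup>\<star> \<otimes> e"
      using a e as by (simp add: d_def minus_eq invol_add invol_minus invol_mult es)
    have "d\<^sup>\<star> \<otimes> d = \<zero>"
      using a as e d ed qd by (simp add: ds minus_eq l_distr l_minus m_assoc)
    then have "d\<^sup>\<star> = \<zero>" using proper[of "d\<^sup>\<star>"] d by (simp add: invol_invol)
    then have "d = \<zero>" using invol_invol[OF d(1)] by simp
    then show ?thesis by (simp add: d_def)
  qed
  then have "e \<otimes> a = a" using a e by (metis m_closed r_right_minus_eq)
  moreover have "e = a \<otimes> (z \<otimes> a\<^sup>\<star>)" using a as z by (simp add: e_def m_assoc)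
  ultimately show ?thesis
    using that[of e "z \<otimes> a\<^sup>\<star>"] e ee es z as by (simp add: projection_def)
qed

text \<open>The projection comes from any nonzero element of \<open>I\<close> and lies in
  \<open>I\<close>. A nonzero x with ex = x also lies in \<open>I\<close>, so by minimality xR is
  all of \<open>I\<close> and contains \<open>e\<close>. This last property later supplies inverses
  in the corner.\<close>

lemma minimal_right_ideal_projection:
  assumes min: "minimal_right_ideal I R"
  obtains e where "projection R e" "e \<noteq> \<zero>"
    "\<And>x. \<lbrakk>x \<in> carrier R; e \<otimes> x = x; x \<noteq> \<zero>\<rbrakk> \<Longrightarrow> \<exists>y \<in> carrier R. x \<otimes> y = e"
proof -
  have I: "right_ideal I R" "I \<noteq> {\<zero>}" using min by (auto simp: minimal_right_ideal_def)
  then obtain a where a: "a \<in> I" "a \<noteq> \<zero>" using right_ideal_zero by blast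
  have ac: "a \<in> carrier R" using a right_ideal_subset[OF I(1)] by blast
  obtain e x where e: "projection R e" "e \<otimes> a = a" "x \<in> carrier R" "e = a \<otimes> x"
    using range_projection[OF ac] by blast
  have eI: "e \<in> I" using e a right_ideal.r_closed[OF I(1)] by simp
  have "\<exists>y \<in> carrier R. x \<otimes> y = e" if x: "x \<in> carrier R" "e \<otimes> x = x" "x \<noteq> \<zero>" for x
  proof -
    let ?X = "{x \<otimes> y | y. y \<in> carrier R}"
    have xI: "x \<in> I" using right_ideal.r_closed[OF I(1) eI x(1)] x by simp
    have "?X \<subseteq> I" using right_ideal.r_closed[OF I(1) xI] by blast
    then have "?X = {\<zero>} \<or> ?X = I"
      using min principal_right_ideal[OF x(1)] unfolding minimal_right_ideal_def by blast
    moreover have "x \<in> ?X" using x(1) by (force intro: exI[of _ \<one>])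
    ultimately have "e \<in> ?X" using eI x by blast
    then show ?thesis by auto
  qed
  moreover have "e \<noteq> \<zero>" using e a ac by auto
  ultimately show ?thesis using that e by blast
qed

end


section \<open>Hermitian spaces\<close>

text \<open>A corner inherits the extra record fields of \<open>R\<close>, while representability
  asks for a plain \<open>star_ring\<close> record; truncation removes these fields.\<close>

lemma star_ring_truncate:
  assumes "star_ring S"
  shows "star_ring (star_ring.truncate S)"
proof -
  interpret S: star_ring S by (rule assms)
  show ?thesis
  proof (intro star_ring.intro star_ring_axioms.intro ringI abelian_groupI monoidI)
    fix x assume "x \<in> carrier (star_ring.truncate S)"
    then show "\<exists>y \<in> carrier (star_ring.truncate S).
        y \<oplus>\<^bsub>star_ring.truncate S\<^esub> x = \<zero>\<^bsub>star_ring.truncate S\<^esub>"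
      using S.l_neg S.a_inv_closed by (auto simp: star_ring.defs)
  qed (auto simp: star_ring.defs S.a_ac S.m_assoc S.l_distr S.r_distr
      S.invol_closed S.invol_add S.invol_mult S.invol_invol)
qed

text \<open>The hermitian law makes the adjoint relation symmetric, so that taking adjoints is an
  involution. The form constructed below from the involution of \<open>R\<close> satisfies
  it.\<close>

locale hermitian_space = inner_product_space F V
  for F :: "('f, 'm) star_ring_scheme" (structure)
    and V :: "('f, 'v, 'n) inner_space_scheme" (structure) +
  assumes hermitian:
    "\<lbrakk>v \<in> carrier V; w \<in> carrier V\<rbrakk> \<Longrightarrow> form V w v = (form V v w)\<^sup>\<star>"
begin

lemma is_adjointD:
  assumes "is_adjoint F V \<phi> \<psi>" "v \<in> carrier V" "w \<in> carrier V"
  shows "form V (\<phi> v) w = form V v (\<psi> w)"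
  using assms by (simp add: is_adjoint_def)

lemma endomorphisms_closed: "\<lbrakk>\<phi> \<in> endomorphisms F V; v \<in> carrier V\<rbrakk> \<Longrightarrow> \<phi> v \<in> carrier V"
  by (auto simp: endomorphisms_def)

lemma endomorphisms_add:
  "\<lbrakk>\<phi> \<in> endomorphisms F V; v \<in> carrier V; w \<in> carrier V\<rbrakk> \<Longrightarrow>
    \<phi> (v \<oplus>\<^bsub>V\<^esub> w) = \<phi> v \<oplus>\<^bsub>V\<^esub> \<phi> w"
  by (auto simp: endomorphisms_def)

lemma endomorphisms_rsmult:
  "\<lbrakk>\<phi> \<in> endomorphisms F V; v \<in> carrier V; a \<in> carrier F\<rbrakk> \<Longrightarrow>
    \<phi> (v \<bullet>\<^bsub>V\<^esub> a) = \<phi> v \<bullet>\<^bsub>V\<^esub> a"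
  by (auto simp: endomorphisms_def)

lemma endomorphismsI:
  assumes "\<And>v. v \<in> carrier V \<Longrightarrow> f v \<in> carrier V"
    and "\<And>v w. \<lbrakk>v \<in> carrier V; w \<in> carrier V\<rbrakk> \<Longrightarrow> f (v \<oplus>\<^bsub>V\<^esub> w) = f v \<oplus>\<^bsub>V\<^esub> f w"
    and "\<And>v a. \<lbrakk>v \<in> carrier V; a \<in> carrier F\<rbrakk> \<Longrightarrow> f (v \<bullet>\<^bsub>V\<^esub> a) = f v \<bullet>\<^bsub>V\<^esub> a"
  shows "(\<lambda>v \<in> carrier V. f v) \<in> endomorphisms F V"
  using assms by (auto simp: endomorphisms_def rsmult_closed)

lemma endomorphisms_ext:
  "\<lbrakk>\<phi> \<in> endomorphisms F V; \<psi> \<in> endomorphisms F V; \<And>v. v \<in> carrier V \<Longrightarrow> \<phi> v = \<psi> v\<rbrakk> \<Longrightarrow> \<phi> = \<psi>"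
  by (rule PiE_ext[of _ "carrier V" "\<lambda>_. carrier V"]) (auto simp: endomorphisms_def)

text \<open>Swap the two arguments by the hermitian law, use the given adjoint relation, and swap
  back; the two occurrences of the involution of \<open>F\<close> match.\<close>

lemma is_adjoint_sym:
  assumes "is_adjoint F V \<phi> \<psi>" "\<phi> \<in> endomorphisms F V"
  shows "is_adjoint F V \<psi> \<phi>"
proof -
  have \<psi>: "\<psi> \<in> endomorphisms F V" using assms by (simp add: is_adjoint_def)
  have "form V (\<psi> v) w = form V v (\<phi> w)" if v: "v \<in> carrier V" and w: "w \<in> carrier V" for v w
    using hermitian[of w "\<psi> v"] hermitian[of "\<phi> w" v] is_adjointD[OF assms(1) w v]
      endomorphisms_closed[OF \<psi> v] endomorphisms_closed[OF assms(2) w] v w by simp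
  then show ?thesis using assms by (simp add: is_adjoint_def)
qed

lemma End_star_invol:
  assumes "is_adjoint F V \<phi> \<psi>"
  shows "\<phi>\<^sup>\<star>\<^bsub>End_star F V\<^esub> = \<psi>"
  using assms is_adjoint_unique by (auto simp: End_star_def)

text \<open>Sums, negatives and reversed products of adjoints are adjoints of the sums, negatives
  and products, which gives closure. The ring laws are then checked pointwise, and the laws of the
  involution follow from uniqueness of adjoints.\<close>

lemma star_ring_End_star: "star_ring (End_star F V)"
proof -
  let ?E = "End_star F V"
  note clos = endomorphisms_closed and addh = endomorphisms_add and smult = endomorphisms_rsmult
  have carr: "\<phi> \<in> carrier ?E \<longleftrightarrow> \<phi> \<in> endomorphisms F V \<and> (\<exists>\<psi>. is_adjoint F V \<phi> \<psi>)" for \<phi>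
    by (simp add: End_star_def)
  have carrE: "\<exists>\<psi>. \<phi> \<in> endomorphisms F V \<and> \<psi> \<in> endomorphisms F V \<and> is_adjoint F V \<phi> \<psi>"
    if "\<phi> \<in> carrier ?E" for \<phi>
    using that by (auto simp: carr is_adjoint_def)
  have ops: "\<phi> \<oplus>\<^bsub>?E\<^esub> \<psi> = (\<lambda>v \<in> carrier V. \<phi> v \<oplus>\<^bsub>V\<^esub> \<psi> v)"
      "\<phi> \<otimes>\<^bsub>?E\<^esub> \<psi> = (\<lambda>v \<in> carrier V. \<phi> (\<psi> v))"
      "\<zero>\<^bsub>?E\<^esub> = (\<lambda>v \<in> carrier V. \<zero>\<^bsub>V\<^esub>)" "\<one>\<^bsub>?E\<^esub> = (\<lambda>v \<in> carrier V. v)" for \<phi> \<psi>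
    by (simp_all add: End_star_def)
  have smult0: "\<zero>\<^bsub>V\<^esub> \<bullet>\<^bsub>V\<^esub> a = \<zero>\<^bsub>V\<^esub>" if a: "a \<in> carrier F" for a
    using rsmult_add_left[of "\<zero>\<^bsub>V\<^esub>" "\<zero>\<^bsub>V\<^esub>" a] rsmult_closed[of "\<zero>\<^bsub>V\<^esub>" a] a
      V.add.l_cancel_one[of "\<zero>\<^bsub>V\<^esub> \<bullet>\<^bsub>V\<^esub> a" "\<zero>\<^bsub>V\<^esub> \<bullet>\<^bsub>V\<^esub> a"] by simp
  have form0: "form V v \<zero>\<^bsub>V\<^esub> = \<zero>" "form V \<zero>\<^bsub>V\<^esub> v = \<zero>" if v: "v \<in> carrier V" for v
  proof -
    show *: "form V v \<zero>\<^bsub>V\<^esub> = \<zero>"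
      using form_add_right[of v "\<zero>\<^bsub>V\<^esub>" "\<zero>\<^bsub>V\<^esub>"] form_closed[of v "\<zero>\<^bsub>V\<^esub>"] v
        F.add.l_cancel_one[of "form V v \<zero>\<^bsub>V\<^esub>" "form V v \<zero>\<^bsub>V\<^esub>"] by simp
    show "form V \<zero>\<^bsub>V\<^esub> v = \<zero>" using orthosymmetric[of v "\<zero>\<^bsub>V\<^esub>"] * v by simp
  qed
  have form_neg: "form V (\<ominus>\<^bsub>V\<^esub> v) w = \<ominus> form V v w" "form V v (\<ominus>\<^bsub>V\<^esub> w) = \<ominus> form V v w"
    if v: "v \<in> carrier V" and w: "w \<in> carrier V" for v w
  proof -
    show "form V (\<ominus>\<^bsub>V\<^esub> v) w = \<ominus> form V v w"
      using form_add_left[of "\<ominus>\<^bsub>V\<^esub> v" v w] v w form0 form_closed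
      by (simp add: V.l_neg F.minus_equality)
    show "form V v (\<ominus>\<^bsub>V\<^esub> w) = \<ominus> form V v w"
      using form_add_right[of v "\<ominus>\<^bsub>V\<^esub> w" w] v w form0 form_closed
      by (simp add: V.l_neg F.minus_equality)
  qed
  have smult_neg: "(\<ominus>\<^bsub>V\<^esub> v) \<bullet>\<^bsub>V\<^esub> a = \<ominus>\<^bsub>V\<^esub> (v \<bullet>\<^bsub>V\<^esub> a)"
    if v: "v \<in> carrier V" and a: "a \<in> carrier F" for v a
    using rsmult_add_left[of "\<ominus>\<^bsub>V\<^esub> v" v a] v a smult0 rsmult_closed
    by (simp add: V.l_neg V.minus_equality)
  have add_endo: "\<phi> \<oplus>\<^bsub>?E\<^esub> \<psi> \<in> endomorphisms F V"
    if "\<phi> \<in> endomorphisms F V" "\<psi> \<in> endomorphisms F V" for \<phi> \<psi>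
    unfolding ops
    by (rule endomorphismsI) (use that in \<open>simp_all add: clos addh smult V.a_ac rsmult_add_left\<close>)
  have mult_endo: "\<phi> \<otimes>\<^bsub>?E\<^esub> \<psi> \<in> endomorphisms F V"
    if "\<phi> \<in> endomorphisms F V" "\<psi> \<in> endomorphisms F V" for \<phi> \<psi>
    unfolding ops
    by (rule endomorphismsI) (use that in \<open>simp_all add: clos addh smult\<close>)
  have add_adj: "is_adjoint F V (\<phi> \<oplus>\<^bsub>?E\<^esub> \<psi>) (\<phi>' \<oplus>\<^bsub>?E\<^esub> \<psi>')"
    if *: "\<phi> \<in> endomorphisms F V" "\<psi> \<in> endomorphisms F V" "is_adjoint F V \<phi> \<phi>'" "is_adjoint F V \<psi> \<psi>'"
    for \<phi> \<psi> \<phi>' \<psi>'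
  proof -
    have **: "\<phi>' \<in> endomorphisms F V" "\<psi>' \<in> endomorphisms F V" using * by (auto simp: is_adjoint_def)
    show ?thesis unfolding is_adjoint_def
    proof (intro conjI ballI)
      show "\<phi>' \<oplus>\<^bsub>?E\<^esub> \<psi>' \<in> endomorphisms F V" by (rule add_endo[OF **])
    qed (use * ** in \<open>simp add: ops clos form_add_left form_add_right is_adjointD\<close>)
  qed
  have mult_adj: "is_adjoint F V (\<phi> \<otimes>\<^bsub>?E\<^esub> \<psi>) (\<psi>' \<otimes>\<^bsub>?E\<^esub> \<phi>')"
    if *: "\<phi> \<in> endomorphisms F V" "\<psi> \<in> endomorphisms F V" "is_adjoint F V \<phi> \<phi>'" "is_adjoint F V \<psi> \<psi>'"
    for \<phi> \<psi> \<phi>' \<psi>'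
  proof -
    have **: "\<phi>' \<in> endomorphisms F V" "\<psi>' \<in> endomorphisms F V" using * by (auto simp: is_adjoint_def)
    show ?thesis unfolding is_adjoint_def
    proof (intro conjI ballI)
      show "\<psi>' \<otimes>\<^bsub>?E\<^esub> \<phi>' \<in> endomorphisms F V" by (rule mult_endo[OF **(2,1)])
    qed (use * ** in \<open>simp add: ops clos is_adjointD\<close>)
  qed
  have zero_endo: "\<zero>\<^bsub>?E\<^esub> \<in> endomorphisms F V" and one_endo: "\<one>\<^bsub>?E\<^esub> \<in> endomorphisms F V"
    unfolding ops by (rule endomorphismsI; simp add: smult0)+
  have zero_adj: "is_adjoint F V \<zero>\<^bsub>?E\<^esub> \<zero>\<^bsub>?E\<^esub>" and one_adj: "is_adjoint F V \<one>\<^bsub>?E\<^esub> \<one>\<^bsub>?E\<^esub>"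
    using zero_endo one_endo by (auto simp: is_adjoint_def ops form0)
  have uminus_endo: "(\<lambda>v \<in> carrier V. \<ominus>\<^bsub>V\<^esub> (\<phi> v)) \<in> endomorphisms F V"
    if "\<phi> \<in> endomorphisms F V" for \<phi>
    by (rule endomorphismsI)
      (use that in \<open>simp_all add: clos addh smult V.minus_add smult_neg\<close>)
  have uminus_adj: "is_adjoint F V (\<lambda>v \<in> carrier V. \<ominus>\<^bsub>V\<^esub> (\<phi> v)) (\<lambda>v \<in> carrier V. \<ominus>\<^bsub>V\<^esub> (\<psi> v))"
    if *: "\<phi> \<in> endomorphisms F V" "is_adjoint F V \<phi> \<psi>" for \<phi> \<psi>
  proof -
    have **: "\<psi> \<in> endomorphisms F V" using * by (auto simp: is_adjoint_def)
    then show ?thesis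
      using * uminus_endo by (simp add: is_adjoint_def clos form_neg)
  qed
  have add_closed: "\<phi> \<oplus>\<^bsub>?E\<^esub> \<psi> \<in> carrier ?E" and mult_closed: "\<phi> \<otimes>\<^bsub>?E\<^esub> \<psi> \<in> carrier ?E"
    if "\<phi> \<in> carrier ?E" "\<psi> \<in> carrier ?E" for \<phi> \<psi>
    using that add_endo mult_endo add_adj mult_adj unfolding carr by blast+
  have zero_closed: "\<zero>\<^bsub>?E\<^esub> \<in> carrier ?E" and one_closed: "\<one>\<^bsub>?E\<^esub> \<in> carrier ?E"
    using zero_endo one_endo zero_adj one_adj unfolding carr by blast+
  have endo: "\<phi> \<in> endomorphisms F V" if "\<phi> \<in> carrier ?E" for \<phi> using that by (simp add: carr)
  note mem = add_closed[THEN endo] mult_closed[THEN endo] zero_closed[THEN endo]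
    one_closed[THEN endo] add_closed mult_closed zero_closed one_closed
  have "ring ?E"
  proof (intro ringI abelian_groupI monoidI)
    fix x y z assume xyz: "x \<in> carrier ?E" "y \<in> carrier ?E" "z \<in> carrier ?E"
    note xyz' = xyz[THEN endo]
    show "x \<oplus>\<^bsub>?E\<^esub> y \<oplus>\<^bsub>?E\<^esub> z = x \<oplus>\<^bsub>?E\<^esub> (y \<oplus>\<^bsub>?E\<^esub> z)"
      by (rule endomorphisms_ext) (use xyz xyz' in \<open>simp_all add: mem, simp add: ops clos V.a_ac\<close>)
    show "x \<otimes>\<^bsub>?E\<^esub> y \<otimes>\<^bsub>?E\<^esub> z = x \<otimes>\<^bsub>?E\<^esub> (y \<otimes>\<^bsub>?E\<^esub> z)"
      by (rule endomorphisms_ext) (use xyz xyz' in \<open>simp_all add: mem, simp add: ops clos\<close>)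
    show "(x \<oplus>\<^bsub>?E\<^esub> y) \<otimes>\<^bsub>?E\<^esub> z = x \<otimes>\<^bsub>?E\<^esub> z \<oplus>\<^bsub>?E\<^esub> y \<otimes>\<^bsub>?E\<^esub> z"
      by (rule endomorphisms_ext) (use xyz xyz' in \<open>simp_all add: mem, simp add: ops clos\<close>)
    show "z \<otimes>\<^bsub>?E\<^esub> (x \<oplus>\<^bsub>?E\<^esub> y) = z \<otimes>\<^bsub>?E\<^esub> x \<oplus>\<^bsub>?E\<^esub> z \<otimes>\<^bsub>?E\<^esub> y"
      by (rule endomorphisms_ext) (use xyz xyz' in \<open>simp_all add: mem, simp add: ops clos addh\<close>)
    show "x \<oplus>\<^bsub>?E\<^esub> y = y \<oplus>\<^bsub>?E\<^esub> x"
      by (rule endomorphisms_ext) (use xyz xyz' in \<open>simp_all add: mem, simp add: ops clos V.a_ac\<close>)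
    show "\<zero>\<^bsub>?E\<^esub> \<oplus>\<^bsub>?E\<^esub> x = x"
      by (rule endomorphisms_ext) (use xyz xyz' in \<open>simp_all add: mem, simp add: ops clos\<close>)
    show "\<one>\<^bsub>?E\<^esub> \<otimes>\<^bsub>?E\<^esub> x = x"
      by (rule endomorphisms_ext) (use xyz xyz' in \<open>simp_all add: mem, simp add: ops clos\<close>)
    show "x \<otimes>\<^bsub>?E\<^esub> \<one>\<^bsub>?E\<^esub> = x"
      by (rule endomorphisms_ext) (use xyz xyz' in \<open>simp_all add: mem, simp add: ops clos\<close>)
    show "\<exists>y \<in> carrier ?E. y \<oplus>\<^bsub>?E\<^esub> x = \<zero>\<^bsub>?E\<^esub>"
    proof (rule bexI)
      show n: "(\<lambda>v \<in> carrier V. \<ominus>\<^bsub>V\<^esub> (x v)) \<in> carrier ?E"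
        using xyz(1) uminus_endo uminus_adj unfolding carr by blast
      show "(\<lambda>v \<in> carrier V. \<ominus>\<^bsub>V\<^esub> (x v)) \<oplus>\<^bsub>?E\<^esub> x = \<zero>\<^bsub>?E\<^esub>"
        by (auto simp: ops clos xyz' V.l_neg intro!: restrict_ext)
    qed
  qed (use mem in auto)
  then show ?thesis
  proof (intro star_ring.intro star_ring_axioms.intro)
    fix a assume a: "a \<in> carrier ?E"
    obtain a' where a': "a \<in> endomorphisms F V" "a' \<in> endomorphisms F V" "is_adjoint F V a a'"
      using carrE[OF a] by blast
    note as = End_star_invol[OF a'(3)] and sym = is_adjoint_sym[OF a'(3,1)]
    show "a\<^sup>\<star>\<^bsub>?E\<^esub> \<in> carrier ?E" using as sym a' carr by auto
    show "(a\<^sup>\<star>\<^bsub>?E\<^esub>)\<^sup>\<star>\<^bsub>?E\<^esub> = a" unfolding as by (rule End_star_invol[OF sym])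
    fix b assume b: "b \<in> carrier ?E"
    obtain b' where b': "b \<in> endomorphisms F V" "b' \<in> endomorphisms F V" "is_adjoint F V b b'"
      using carrE[OF b] by blast
    note bs = End_star_invol[OF b'(3)]
    show "(a \<oplus>\<^bsub>?E\<^esub> b)\<^sup>\<star>\<^bsub>?E\<^esub> = a\<^sup>\<star>\<^bsub>?E\<^esub> \<oplus>\<^bsub>?E\<^esub> b\<^sup>\<star>\<^bsub>?E\<^esub>"
      unfolding as bs by (rule End_star_invol[OF add_adj]) (use a' b' in auto)
    show "(a \<otimes>\<^bsub>?E\<^esub> b)\<^sup>\<star>\<^bsub>?E\<^esub> = b\<^sup>\<star>\<^bsub>?E\<^esub> \<otimes>\<^bsub>?E\<^esub> a\<^sup>\<star>\<^bsub>?E\<^esub>"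
      unfolding as bs by (rule End_star_invol[OF mult_adj]) (use a' b' in auto)
  qed
qed

end


section \<open>The representation\<close>

context star_regular_ring begin

text \<open>The division ring eRe and the space Re both consist of elements of \<open>R\<close>, so
  the type of \<open>R\<close> serves for scalars and vectors alike. The scalars act from the right
  and hence commute with left multiplication by \<open>R\<close>.\<close>

lemma left_ideal_representation:
  assumes si: "subdirectly_irreducible R"
    and proj: "projection R e" and e0: "e \<noteq> \<zero>"
    and div: "\<And>x. \<lbrakk>x \<in> carrier R; e \<otimes> x = x; x \<noteq> \<zero>\<rbrakk> \<Longrightarrow> \<exists>y \<in> carrier R. x \<otimes> y = e"
  shows "representable TYPE('a) TYPE('a) R"
proof -
  have e: "e \<in> carrier R" "e \<otimes> e = e" "e\<^sup>\<star> = e" using proj by (auto simp: projection_def)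
  define F :: "'a star_ring" where "F = star_ring.truncate (corner R e)"
  have F_simps [simp]: "x \<otimes>\<^bsub>F\<^esub> y = x \<otimes> y" "x \<oplus>\<^bsub>F\<^esub> y = x \<oplus> y"
    "\<zero>\<^bsub>F\<^esub> = \<zero>" "\<one>\<^bsub>F\<^esub> = e" "x\<^sup>\<star>\<^bsub>F\<^esub> = x\<^sup>\<star>" for x y
    by (simp_all add: F_def star_ring.defs corner_def)
  have F_carrier: "carrier F = {x \<in> carrier R. e \<otimes> x = x \<and> x \<otimes> e = x}"
    using carrier_corner[OF e(1,2)] by (simp add: F_def star_ring.defs)
  \<comment> \<open>The multiplication and unit fields are mere fillers, since only the additive
    part of the record enters the notion of a space.\<close>
  define V :: "('a, 'a) inner_space" where
    "V = \<lparr>carrier = {v \<in> carrier R. v \<otimes> e = v}, monoid.mult = (\<otimes>), one = \<one>,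
      ring.zero = \<zero>, add = (\<oplus>), rsmult = (\<otimes>), form = (\<lambda>v w. v\<^sup>\<star> \<otimes> w)\<rparr>"
  have V_simps [simp]: "x \<oplus>\<^bsub>V\<^esub> y = x \<oplus> y" "\<zero>\<^bsub>V\<^esub> = \<zero>" "x \<bullet>\<^bsub>V\<^esub> y = x \<otimes> y"
    "form V x y = x\<^sup>\<star> \<otimes> y" for x y
    by (simp_all add: V_def)
  have V_carrier: "carrier V = {v \<in> carrier R. v \<otimes> e = v}" by (simp add: V_def)
  interpret F: star_ring F
    unfolding F_def by (rule star_ring_truncate[OF star_ring_corner[OF proj]])
  have right_inverse: "\<exists>y \<in> carrier F. x \<otimes> y = e" if x: "x \<in> carrier F" "x \<noteq> \<zero>" for x
  proof -
    have xc: "x \<in> carrier R" "e \<otimes> x = x" "x \<otimes> e = x" using x by (auto simp: F_carrier)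
    obtain y where y: "y \<in> carrier R" "x \<otimes> y = e" using div[OF xc(1,2) x(2)] by blast
    \<comment> \<open>The inverse \<open>y\<close> need not lie in the corner; compressing it to eye
      keeps the equation because xe = x.\<close>
    have "e \<otimes> y \<otimes> e \<in> carrier F" using y by (auto simp: F_def star_ring.defs corner_def)
    moreover have "x \<otimes> (e \<otimes> y \<otimes> e) = x \<otimes> e \<otimes> y \<otimes> e"
      using xc(1) e(1) y(1) by (simp only: m_assoc m_closed)
    then have "x \<otimes> (e \<otimes> y \<otimes> e) = e" using xc y e by simp
    ultimately show ?thesis by blast
  qed
  have div_F: "division_star_ring F"
  proof (intro division_star_ring.intro division_star_ring_axioms.intro F.star_ring_axioms equalityI subsetI)
    fix x assume "x \<in> Units F"
    then show "x \<in> carrier F - {\<zero>\<^bsub>F\<^esub>}"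
      using e0 by (auto simp: Units_def F_carrier)
  next
    fix x assume "x \<in> carrier F - {\<zero>\<^bsub>F\<^esub>}"
    then have x: "x \<in> carrier F" "x \<noteq> \<zero>" by auto
    obtain y where y: "y \<in> carrier F" "x \<otimes> y = e" using right_inverse[OF x] by blast
    have "y \<noteq> \<zero>" using y x e0 by (auto simp: F_carrier)
    then obtain z where z: "z \<in> carrier F" "y \<otimes> z = e" using right_inverse y by blast
    \<comment> \<open>The right inverse \<open>y\<close> of \<open>x\<close> has itself a right
      inverse \<open>z\<close>; then x = x(yz) = (xy)z = z, so \<open>y\<close> is a two-sided
      inverse of \<open>x\<close>.\<close>
    have "x = z"
      using x y z by (metis F_simps(1,4) F.inv_unique F.m_assoc F.l_one F.r_one)
    then show "x \<in> Units F" using x y z by (auto simp: Units_def)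
  qed
  have V_group: "abelian_group V"
  proof (rule abelian_groupI)
    fix x assume x: "x \<in> carrier V"
    then have "\<ominus> x \<in> carrier V" using e by (simp add: V_carrier l_minus)
    then show "\<exists>y \<in> carrier V. y \<oplus>\<^bsub>V\<^esub> x = \<zero>\<^bsub>V\<^esub>"
      using x l_neg by (auto simp: V_carrier)
  qed (use e in \<open>auto simp: V_carrier l_distr a_ac\<close>)
  have F_sub: "x \<in> carrier R" if "x \<in> carrier F" for x using that by (simp add: F_carrier)
  have V_sub: "x \<in> carrier R" if "x \<in> carrier V" for x using that by (simp add: V_carrier)
  have form_closed: "v\<^sup>\<star> \<otimes> w \<in> carrier F" if "v \<in> carrier V" "w \<in> carrier V" for v w
  proof -
    have *: "v \<in> carrier R" "w \<in> carrier R" "v \<otimes> e = v" "w \<otimes> e = w" using that by (auto simp: V_carrier)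
    have "e \<otimes> v\<^sup>\<star> = v\<^sup>\<star>" using invol_mult[OF *(1) e(1)] * e by simp
    then have "e \<otimes> (v\<^sup>\<star> \<otimes> w) = v\<^sup>\<star> \<otimes> w"
      using * e m_assoc[of e "v\<^sup>\<star>" w] by (simp add: invol_closed)
    then show ?thesis using * e by (simp add: F_carrier invol_closed m_assoc)
  qed
  have rep: "r \<otimes> v \<in> carrier V" if "r \<in> carrier R" "v \<in> carrier V" for r v
    using that e by (simp add: V_carrier m_assoc)
  interpret H: hermitian_space F V
  proof (intro hermitian_space.intro inner_product_space.intro inner_product_space_axioms.intro
      hermitian_space_axioms.intro div_F V_group)
    show "v \<bullet>\<^bsub>V\<^esub> a \<in> carrier V" if "v \<in> carrier V" "a \<in> carrier F" for v a
      using that e by (simp add: V_carrier F_carrier m_assoc)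
    \<comment> \<open>Properness concerns a product with the adjoint on the right, whereas the form
      puts it on the left; hence it is applied to \<open>v\<^sup>\<star>\<close>.\<close>
    show "v = \<zero>\<^bsub>V\<^esub>" if v: "v \<in> carrier V" "form V v v = \<zero>\<^bsub>F\<^esub>" for v
    proof -
      have "v\<^sup>\<star> = \<zero>" using proper[of "v\<^sup>\<star>"] v V_sub by (simp add: invol_closed invol_invol)
      then show ?thesis using invol_invol[OF V_sub[OF v(1)]] by simp
    qed
    show "form V v w = \<zero>\<^bsub>F\<^esub> \<longleftrightarrow> form V w v = \<zero>\<^bsub>F\<^esub>" if "v \<in> carrier V" "w \<in> carrier V" for v w
      using invol_mult[of "v\<^sup>\<star>" w] invol_mult[of "w\<^sup>\<star>" v] V_sub[OF that(1)] V_sub[OF that(2)]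
      by (auto simp: invol_closed invol_invol)
    show "form V v w \<in> carrier F" if "v \<in> carrier V" "w \<in> carrier V" for v w
      using form_closed[OF that] by simp
  qed (simp_all add: F_carrier V_carrier invol_closed invol_add invol_mult invol_invol
      l_distr r_distr m_assoc)
  let ?E = "End_star F V"
  define \<rho> where "\<rho> r = (\<lambda>v \<in> carrier V. r \<otimes> v)" for r
  have \<rho>_endo: "\<rho> r \<in> endomorphisms F V" if "r \<in> carrier R" for r
    unfolding \<rho>_def
    by (rule H.endomorphismsI) (use that in \<open>auto simp: rep r_distr m_assoc V_sub F_sub\<close>)
  \<comment> \<open>Both sides of the adjoint equation equal
    \<open>v\<^sup>\<star> \<otimes> r\<^sup>\<star> \<otimes> w\<close>.\<close>
  have \<rho>_adj: "is_adjoint F V (\<rho> r) (\<rho> (r\<^sup>\<star>))" if r: "r \<in> carrier R" for r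
    unfolding is_adjoint_def
    using \<rho>_endo[OF invol_closed[OF r]] r
    by (auto simp: \<rho>_def V_sub invol_mult invol_closed invol_invol m_assoc)
  have "\<rho> \<in> ring_hom R ?E"
  proof (rule ring_hom_memI)
    show "\<rho> r \<in> carrier ?E" if "r \<in> carrier R" for r
      using that \<rho>_endo \<rho>_adj by (auto simp: End_star_def)
  qed (auto simp: End_star_def \<rho>_def l_distr m_assoc rep V_sub intro!: restrict_ext)
  moreover have "inj_on \<rho> (carrier R)"
  proof (rule inj_onI, rule ccontr)
    fix r s assume r: "r \<in> carrier R" and s: "s \<in> carrier R" and eq: "\<rho> r = \<rho> s" and "r \<noteq> s"
    then have d: "r \<ominus> s \<in> carrier R" "r \<ominus> s \<noteq> \<zero>" by auto
    \<comment> \<open>Faithfulness is primeness applied to r - s and \<open>e\<close>: the vector te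
      witnesses that the two left multiplications differ.\<close>
    obtain t where t: "t \<in> carrier R" "(r \<ominus> s) \<otimes> t \<otimes> e \<noteq> \<zero>"
      using subdirectly_irreducible_prime[OF si d e(1) e0] by blast
    have te: "t \<otimes> e \<in> carrier V" using t e by (simp add: V_carrier m_assoc)
    have "\<rho> r (t \<otimes> e) = \<rho> s (t \<otimes> e)" using eq by simp
    then have "r \<otimes> (t \<otimes> e) = s \<otimes> (t \<otimes> e)" using te by (simp add: \<rho>_def)
    then have "(r \<ominus> s) \<otimes> t \<otimes> e = \<zero>"
      using r s t e by (simp add: m_assoc minus_eq l_distr l_minus r_neg)
    then show False using t by simp
  qed
  moreover have "\<rho> (r\<^sup>\<star>) = (\<rho> r)\<^sup>\<star>\<^bsub>?E\<^esub>" if "r \<in> carrier R" for r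
    using H.End_star_invol[OF \<rho>_adj[OF that]] by simp
  ultimately have "star_embedding R ?E \<rho>"
    using star_ring_axioms H.star_ring_End_star by (simp add: star_embedding_def)
  then show ?thesis
    unfolding representable_def using H.inner_product_space_axioms by blast
qed

end

theorem theorem6:
  fixes R :: "('a, 'm) star_ring_scheme" (structure)
  assumes "star_regular_ring R"
    and "subdirectly_irreducible R"
    and "socle R \<noteq> {\<zero>}"
  shows "socle R = minimal_ideal R \<and>
    (\<forall>e \<in> minimal_ideal R. projection R e \<longrightarrow> artinian_ring (corner R e)) \<and>
    representable TYPE('a) TYPE('a) R"
proof -
  interpret star_regular_ring R by (rule assms(1))
  have soc: "socle R = minimal_ideal R"
    by (rule socle_eq_minimal_ideal[OF assms(2,3)])
  obtain I where "minimal_right_ideal I R"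
    using minimal_right_ideal_ex[OF assms(3)] by blast
  then obtain e where "projection R e" "e \<noteq> \<zero>"
      "\<And>x. \<lbrakk>x \<in> carrier R; e \<otimes> x = x; x \<noteq> \<zero>\<rbrakk> \<Longrightarrow> \<exists>y \<in> carrier R. x \<otimes> y = e"
    using minimal_right_ideal_projection by blast
  then have "representable TYPE('a) TYPE('a) R"
    by (rule left_ideal_representation[OF assms(2)])
  then show ?thesis using soc artinian_corner by auto
qed

end
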